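(* Let $$\Theta=\begin{pmatrix}\mathbb{A}&K&1\\ \mathcal{H}_+\subset\mathcal{H}\subset\mathcal{H}_-& &\mathbb{C}\end{pmatrix}$$ be an L-system with symmetric operator $\dot A$ whose main operator $T$ and the quasi-kernel $\hat A$ of $\operatorname{Re}\mathbb{A}$ satisfy the Hypothesis (H) (see context) with the reference operator $A=\hat A$ and the von Neumann parameter $\kappa$, $0\le\kappa<1$. Then the transfer function $W_\Theta(z)$ and the characteristic function $S(z)$ of the triple $(\dot A,T,\hat A)$ are reciprocals of each other, i.e. $$W_\Theta(z)=\frac{1}{S(z)},\qquad z\in\mathbb{C}_+\cap\rho(T),$$ and $\dfrac{1}{W_\Theta(z)}\in\mathfrak{L}_\kappa$.
   Context: Rigged space. $\dot A$ is a closed densely defined symmetric operator with deficiency indices $(1,1)$ in a Hilbert space $\mathcal{H}$ with inner product $(\cdot,\cdot)$ (linear in the first argument). $\mathcal{H}_+=\mathrm{Dom}(\dot A^* )$ with $(f,g)_+=(f,g)+(\dot A^*f,\dot A^*g)$; $\mathcal{H}_-$ is the space dual to $\mathcal{H}_+$ with respect to $\mathcal{H}$, so $\mathcal{H}_+\subset\mathcal{H}\subset\mathcal{H}_-$, and $(u,f)$ denotes the value of $f\in\mathcal{H}_-$ at $u\in\mathcal{H}_+$ (equal to the $\mathcal{H}$-inner product if $f\in\mathcal{H}$). $[X,Y]$ is the set of bounded linear operators $X\to Y$. Spaces dual to $\mathcal{H}_\pm$ are identified with $\mathcal{H}_\mp$, so $\mathbb{A}\in[\mathcal{H}_+,\mathcal{H}_-]$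 has adjoint $\mathbb{A}^*\in[\mathcal{H}_+,\mathcal{H}_-]$; $\operatorname{Re}\mathbb{A}=(\mathbb{A}+\mathbb{A}^* )/2$, $\operatorname{Im}\mathbb{A}=(\mathbb{A}-\mathbb{A}^* )/(2i)$. L-systems. For $\mathbb{B}=\mathbb{B}^*\in[\mathcal{H}_+,\mathcal{H}_-]$ with $\mathbb{B}\supset\dot A$, its quasi-kernel is the restriction of $\mathbb{B}$ to $\{f\in\mathcal{H}_+:\mathbb{B}f\in\mathcal{H}\}$; $\mathbb{B}$ is a t-self-adjoint bi-extension of $\dot A$ if its quasi-kernel is a self-adjoint operator in $\mathcal{H}$. The class $\Lambda(\dot A)$ consists of operators $T$ with $\dot A\subset T\subset\dot A^*$, $\rho(T)\neq\emptyset$ and $\mathrm{Dom}(\dot A)=\mathrm{Dom}(T)\cap\mathrm{Dom}(T^* )$. A $( * )$-extension of $T\in\Lambda(\dot A)$ is $\mathbb{A}\in[\mathcal{H}_+,\mathcal{H}_-]$ with $\dot A\subset T\subset\mathbb{A}$, $\dot A\subset T^*\subset\mathbb{A}^*$ such that $\operatorname{Re}\mathbb{A}$ is a t-self-adjoint bi-extension of $\dot A$. The array $\Theta$ is an L-system (with $E=\mathbb{C}$, $J=1$) if $\mathbb{A}$ is a $( * )$-extension of some $T\in\Lambda(\dot A)$, $K\in[\mathbb{C},\mathcal{H}_-]$, $K^*\in[\mathcal{H}_+,\mathbb{C}]$, $\operatorname{Im}\mathbb{A}=KK^*$ and $\mathrm{Ran}(K)=\mathrm{Ran}(\operatorname{Im}\mathbb{A})$.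 $T$, the restriction of $\mathbb{A}$ to $\{f\in\mathcal{H}_+:\mathbb{A}f\in\mathcal{H}\}$, is the main operator. The transfer function is $W_\Theta(z)=1-2iK^*(\mathbb{A}-zI)^{-1}K$, $z\in\rho(T)$ (well defined since $\mathrm{Ran}(\mathbb{A}-zI)\supset\mathrm{Ran}(K)$). Hypothesis (H), for a triple $(\dot A,T,A)$ and a parameter $\kappa$: $T\ne T^*$ is a maximal dissipative extension of $\dot A$ (dissipative: $\operatorname{Im}(Tf,f)\ge0$ for $f\in\mathrm{Dom}(T)$), $A$ is a self-adjoint (reference) extension of $\dot A$, and there are deficiency elements $g_\pm\in\mathrm{Ker}(\dot A^*\mp iI)$, $\|g_\pm\|=1$, with $g_+-g_-\in\mathrm{Dom}(A)$ and $g_+-\kappa g_-\in\mathrm{Dom}(T)$, $|\kappa|<1$. The number $\kappa$ is called the von Neumann parameter of $T$; throughout it is real with $0\le\kappa<1$. Livšic and characteristic functions. With such $g_\pm$, the Livšic function of $(\dot A,A)$ is $s(z)=\frac{z-i}{z+i}\cdot\frac{(g_z,g_-)}{(g_z,g_+)}$, $z\in\mathbb{C}_+$, where $0\ne g_z\in\mathrm{Ker}(\dot A^*-zI)$ is arbitrary. The characteristic function of the triple $(\dot A,T,A)$ is $S(z)=\frac{s(z)-\kappa}{\overline{\kappa}\,s(z)-1}$, $z\in\mathbb{C}_+$. Classes. $\mathfrak{L}$ is the class of analytic maps $s$ from $\mathbb{C}_+$ to the unit disk $\mathbb{D}$ such that $s(i)=0$ and, for all $\alpha\in[0,\pi)$,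 $\lim_{z\to\infty}z(s(z)-e^{2i\alpha})=\infty$ in every sector $0<\varepsilon\le\arg z\le\pi-\varepsilon$. $\mathfrak{L}_\kappa$ is the class of functions $S(z)=\frac{s(z)-\kappa}{\overline{\kappa}s(z)-1}$, $z\in\mathbb{C}_+$, with $s\in\mathfrak{L}$. Membership of $1/W_\Theta$ in $\mathfrak{L}_\kappa$ is understood in the sense that $1/W_\Theta$ coincides on $\mathbb{C}_+\cap\rho(T)$ with a function of class $\mathfrak{L}_\kappa$. *)

theory Defs
  imports "HOL-Analysis.Analysis" "HOL-Library.Function_Algebras"
begin

section \<open>Complex Hilbert spaces\<close>

text \<open>The inner product is linear in its first argument. The axiom \<open>cinner_norm\<close> says at once
  that \<open>cinner x x\<close> is real, nonnegative, zero only for \<open>x = 0\<close>, and that it induces the norm.\<close>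

class chilbert_space = banach +
  fixes scaleC :: "complex \<Rightarrow> 'a \<Rightarrow> 'a" (infixr "*\<^sub>C" 75)
    and cinner :: "'a \<Rightarrow> 'a \<Rightarrow> complex"
  assumes scaleR_scaleC: "r *\<^sub>R x = complex_of_real r *\<^sub>C x"
    and scaleC_add_right: "c *\<^sub>C (x + y) = c *\<^sub>C x + c *\<^sub>C y"
    and scaleC_add_left: "(c + d) *\<^sub>C x = c *\<^sub>C x + d *\<^sub>C x"
    and scaleC_scaleC: "c *\<^sub>C (d *\<^sub>C x) = (c * d) *\<^sub>C x"
    and cinner_commute: "cinner x y = cnj (cinner y x)"
    and cinner_add_left: "cinner (x + y) z = cinner x z + cinner y z"
    and cinner_scaleC_left: "cinner (c *\<^sub>C x) y = c * cinner x y"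
    and cinner_norm: "cinner x x = complex_of_real ((norm x)\<^sup>2)"

global_interpretation complex_vector:
  vector_space "scaleC :: complex \<Rightarrow> 'a::chilbert_space \<Rightarrow> 'a"
proof
  fix x :: 'a
  show "1 *\<^sub>C x = x"
    using scaleR_scaleC[of 1 x] by simp
qed (simp_all add: scaleC_add_right scaleC_add_left scaleC_scaleC)

section \<open>Unbounded operators, given by their graphs\<close>

definition linear_operator :: "('a::chilbert_space \<times> 'a) set \<Rightarrow> bool" where
  "linear_operator T \<longleftrightarrow> single_valued T \<and> (0, 0) \<in> T
     \<and> (\<forall>(f, f') \<in> T. \<forall>(g, g') \<in> T. (f + g, f' + g') \<in> T)
     \<and> (\<forall>c. \<forall>(f, f') \<in> T. (c *\<^sub>C f, c *\<^sub>C f') \<in> T)"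

definition apply_op :: "('a \<times> 'a) set \<Rightarrow> 'a \<Rightarrow> 'a" where
  "apply_op T f = (THE h. (f, h) \<in> T)"

definition densely_defined :: "('a::chilbert_space \<times> 'a) set \<Rightarrow> bool" where
  "densely_defined T \<longleftrightarrow> closure (Domain T) = UNIV"

definition op_adjoint :: "('a::chilbert_space \<times> 'a) set \<Rightarrow> ('a \<times> 'a) set" where
  "op_adjoint T = {(g, h). \<forall>(f, f') \<in> T. cinner f' g = cinner f h}"

definition symmetric_operator :: "('a::chilbert_space \<times> 'a) set \<Rightarrow> bool" where
  "symmetric_operator T \<longleftrightarrow> (\<forall>(f, f') \<in> T. \<forall>(g, g') \<in> T. cinner f' g = cinner f g')"

definition self_adjoint_operator :: "('a::chilbert_space \<times> 'a) set \<Rightarrow> bool" where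
  "self_adjoint_operator T \<longleftrightarrow> linear_operator T \<and> densely_defined T \<and> op_adjoint T = T"

definition dissipative_operator :: "('a::chilbert_space \<times> 'a) set \<Rightarrow> bool" where
  "dissipative_operator T \<longleftrightarrow> (\<forall>(f, f') \<in> T. 0 \<le> Im (cinner f' f))"

definition maximal_dissipative_extension ::
    "('a::chilbert_space \<times> 'a) set \<Rightarrow> ('a \<times> 'a) set \<Rightarrow> bool" where
  "maximal_dissipative_extension A T \<longleftrightarrow>
     linear_operator T \<and> A \<subseteq> T \<and> dissipative_operator T
     \<and> (\<forall>T'. linear_operator T' \<and> dissipative_operator T' \<and> T \<subseteq> T' \<longrightarrow> T' = T)"

text \<open>\<open>z\<close> is a regular point of \<open>T\<close> if \<open>T - z\<close> has an everywhere defined bounded inverse \<open>R\<close>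
  (which is then automatically complex linear when \<open>T\<close> is).\<close>

definition resolvent_set :: "('a::chilbert_space \<times> 'a) set \<Rightarrow> complex set" where
  "resolvent_set T = {z. \<exists>R. bounded_linear R
     \<and> (\<forall>y. (R y, y + z *\<^sub>C R y) \<in> T)
     \<and> (\<forall>(f, f') \<in> T. R (f' - z *\<^sub>C f) = f)}"

definition deficiency_space :: "('a::chilbert_space \<times> 'a) set \<Rightarrow> complex \<Rightarrow> 'a set" where
  "deficiency_space A z = {g. (g, z *\<^sub>C g) \<in> op_adjoint A}"

text \<open>The library dimension of an infinite-dimensional space is \<open>0\<close>, so that \<open>dim = 1\<close> does mean
  one-dimensional.\<close>

definition deficiency_indices_1_1 :: "('a::chilbert_space \<times> 'a) set \<Rightarrow> bool" where
  "deficiency_indices_1_1 A \<longleftrightarrow>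
     complex_vector.dim (deficiency_space A \<i>) = 1 \<and>
     complex_vector.dim (deficiency_space A (- \<i>)) = 1"

section \<open>The rigged Hilbert space\<close>

definition hplus :: "('a::chilbert_space \<times> 'a) set \<Rightarrow> 'a set" where
  "hplus A = Domain (op_adjoint A)"

definition inner_plus :: "('a::chilbert_space \<times> 'a) set \<Rightarrow> 'a \<Rightarrow> 'a \<Rightarrow> complex" where
  "inner_plus A f g = cinner f g + cinner (apply_op (op_adjoint A) f) (apply_op (op_adjoint A) g)"

definition norm_plus :: "('a::chilbert_space \<times> 'a) set \<Rightarrow> 'a \<Rightarrow> real" where
  "norm_plus A f = sqrt (Re (inner_plus A f f))"

text \<open>An element \<open>\<phi>\<close> of the dual space is represented by the function \<open>u \<mapsto> (u, \<phi>)\<close> on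
  \<open>hplus A\<close>, extended by \<open>0\<close>. This function is linear in \<open>u\<close>. Addition in the dual space is pointwise,
  whereas \<open>(u, c \<phi>) = cnj c (u, \<phi>)\<close>, which makes the embedding of the Hilbert space linear.\<close>

definition hminus :: "('a::chilbert_space \<times> 'a) set \<Rightarrow> ('a \<Rightarrow> complex) set" where
  "hminus A = {\<phi>. (\<forall>u. u \<notin> hplus A \<longrightarrow> \<phi> u = 0)
     \<and> (\<forall>u \<in> hplus A. \<forall>v \<in> hplus A. \<phi> (u + v) = \<phi> u + \<phi> v)
     \<and> (\<forall>c. \<forall>u \<in> hplus A. \<phi> (c *\<^sub>C u) = c * \<phi> u)
     \<and> (\<exists>C. \<forall>u \<in> hplus A. cmod (\<phi> u) \<le> C * norm_plus A u)}"

definition dual_scale :: "complex \<Rightarrow> ('a \<Rightarrow> complex) \<Rightarrow> ('a \<Rightarrow> complex)" where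
  "dual_scale c \<phi> = (\<lambda>u. cnj c * \<phi> u)"

definition norm_minus :: "('a::chilbert_space \<times> 'a) set \<Rightarrow> ('a \<Rightarrow> complex) \<Rightarrow> real" where
  "norm_minus A \<phi> = (SUP u \<in> {u \<in> hplus A. norm_plus A u \<le> 1}. cmod (\<phi> u))"

definition h_embed :: "('a::chilbert_space \<times> 'a) set \<Rightarrow> 'a \<Rightarrow> ('a \<Rightarrow> complex)" where
  "h_embed A f = (\<lambda>u. if u \<in> hplus A then cinner u f else 0)"

section \<open>Bi-extensions\<close>

text \<open>The bounded operators from \<open>hplus A\<close> to \<open>hminus A\<close>. Only the values on \<open>hplus A\<close> matter, and
  equality of two such operators is equality on \<open>hplus A\<close>.\<close>

definition bounded_plus_minus ::
    "('a::chilbert_space \<times> 'a) set \<Rightarrow> ('a \<Rightarrow> 'a \<Rightarrow> complex) \<Rightarrow> bool" where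
  "bounded_plus_minus A B \<longleftrightarrow>
     (\<forall>u \<in> hplus A. B u \<in> hminus A)
     \<and> (\<forall>u \<in> hplus A. \<forall>v \<in> hplus A. B (u + v) = B u + B v)
     \<and> (\<forall>c. \<forall>u \<in> hplus A. B (c *\<^sub>C u) = dual_scale c (B u))
     \<and> (\<exists>C. \<forall>u \<in> hplus A. norm_minus A (B u) \<le> C * norm_plus A u)"

text \<open>\<open>(u, B\<^sup>* v) = (B u, v)\<close> for \<open>u, v\<close> in \<open>hplus A\<close>, where \<open>(\<phi>, v)\<close> stands for the
  conjugate of \<open>(v, \<phi>)\<close>.\<close>

definition bi_adjoint ::
    "('a::chilbert_space \<times> 'a) set \<Rightarrow> ('a \<Rightarrow> 'a \<Rightarrow> complex) \<Rightarrow> ('a \<Rightarrow> 'a \<Rightarrow> complex)" where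
  "bi_adjoint A B v = (\<lambda>u. if u \<in> hplus A then cnj (B u v) else 0)"

definition re_part ::
    "('a::chilbert_space \<times> 'a) set \<Rightarrow> ('a \<Rightarrow> 'a \<Rightarrow> complex) \<Rightarrow> ('a \<Rightarrow> 'a \<Rightarrow> complex)" where
  "re_part A B u = dual_scale (1 / 2) (B u + bi_adjoint A B u)"

definition im_part ::
    "('a::chilbert_space \<times> 'a) set \<Rightarrow> ('a \<Rightarrow> 'a \<Rightarrow> complex) \<Rightarrow> ('a \<Rightarrow> 'a \<Rightarrow> complex)" where
  "im_part A B u = dual_scale (1 / (2 * \<i>)) (B u - bi_adjoint A B u)"

definition quasi_kernel ::
    "('a::chilbert_space \<times> 'a) set \<Rightarrow> ('a \<Rightarrow> 'a \<Rightarrow> complex) \<Rightarrow> ('a \<times> 'a) set" where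
  "quasi_kernel A B = {(f, h). f \<in> hplus A \<and> B f = h_embed A h}"

definition extends_op ::
    "('a::chilbert_space \<times> 'a) set \<Rightarrow> ('a \<Rightarrow> 'a \<Rightarrow> complex) \<Rightarrow> ('a \<times> 'a) set \<Rightarrow> bool" where
  "extends_op A B T \<longleftrightarrow> (\<forall>(f, h) \<in> T. f \<in> hplus A \<and> B f = h_embed A h)"

definition t_self_adjoint_bi_extension ::
    "('a::chilbert_space \<times> 'a) set \<Rightarrow> ('a \<Rightarrow> 'a \<Rightarrow> complex) \<Rightarrow> bool" where
  "t_self_adjoint_bi_extension A B \<longleftrightarrow>
     bounded_plus_minus A B
     \<and> (\<forall>u \<in> hplus A. bi_adjoint A B u = B u)
     \<and> extends_op A B A
     \<and> self_adjoint_operator (quasi_kernel A B)"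

section \<open>L-systems with input-output space \<open>\<complex>\<close> and \<open>J = 1\<close>\<close>

definition Lambda_class :: "('a::chilbert_space \<times> 'a) set \<Rightarrow> ('a \<times> 'a) set set" where
  "Lambda_class A = {T. linear_operator T \<and> A \<subseteq> T \<and> T \<subseteq> op_adjoint A
     \<and> resolvent_set T \<noteq> {} \<and> Domain A = Domain T \<inter> Domain (op_adjoint T)}"

definition star_extension ::
    "('a::chilbert_space \<times> 'a) set \<Rightarrow> ('a \<times> 'a) set \<Rightarrow> ('a \<Rightarrow> 'a \<Rightarrow> complex) \<Rightarrow> bool" where
  "star_extension A T B \<longleftrightarrow>
     bounded_plus_minus A B
     \<and> A \<subseteq> T \<and> extends_op A B T
     \<and> A \<subseteq> op_adjoint T \<and> extends_op A (bi_adjoint A B) (op_adjoint T)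
     \<and> t_self_adjoint_bi_extension A (re_part A B)"

definition bounded_C_minus ::
    "('a::chilbert_space \<times> 'a) set \<Rightarrow> (complex \<Rightarrow> 'a \<Rightarrow> complex) \<Rightarrow> bool" where
  "bounded_C_minus A K \<longleftrightarrow>
     (\<forall>c. K c \<in> hminus A)
     \<and> (\<forall>c d. K (c + d) = K c + K d)
     \<and> (\<forall>c d. K (c * d) = dual_scale c (K d))
     \<and> (\<exists>C. \<forall>c. norm_minus A (K c) \<le> C * cmod c)"

text \<open>The adjoint of \<open>K\<close> is determined by \<open>(u, K c) = (K\<^sup>* u, c)\<close>, i.e. \<open>K c u = K\<^sup>* u * cnj c\<close>, so
  its value at \<open>u\<close> is \<open>K 1 u\<close>; it is bounded on \<open>hplus A\<close> since \<open>K 1\<close> is in \<open>hminus A\<close>.\<close>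

definition K_adj :: "(complex \<Rightarrow> 'a \<Rightarrow> complex) \<Rightarrow> 'a \<Rightarrow> complex" where
  "K_adj K u = K 1 u"

lemma K_adj_pairing:
  assumes "bounded_C_minus A K"
  shows "K c u = K_adj K u * cnj c"
proof -
  have "K (c * 1) = dual_scale c (K 1)"
    using assms unfolding bounded_C_minus_def by blast
  then show ?thesis
    by (simp add: K_adj_def dual_scale_def)
qed

definition L_system ::
    "('a::chilbert_space \<times> 'a) set \<Rightarrow> ('a \<Rightarrow> 'a \<Rightarrow> complex) \<Rightarrow> (complex \<Rightarrow> 'a \<Rightarrow> complex) \<Rightarrow> bool"
  where
  "L_system A B K \<longleftrightarrow>
     (\<exists>T \<in> Lambda_class A. star_extension A T B)
     \<and> bounded_C_minus A K
     \<and> (\<forall>u \<in> hplus A. im_part A B u = K (K_adj K u))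
     \<and> range K = im_part A B ` hplus A"

definition main_operator ::
    "('a::chilbert_space \<times> 'a) set \<Rightarrow> ('a \<Rightarrow> 'a \<Rightarrow> complex) \<Rightarrow> ('a \<times> 'a) set" where
  "main_operator A B = {(f, h). f \<in> hplus A \<and> B f = h_embed A h}"

definition bi_resolvent ::
    "('a::chilbert_space \<times> 'a) set \<Rightarrow> ('a \<Rightarrow> 'a \<Rightarrow> complex) \<Rightarrow> complex \<Rightarrow> ('a \<Rightarrow> complex) \<Rightarrow> 'a"
  where
  "bi_resolvent A B z \<phi> = (THE u. u \<in> hplus A \<and> B u - h_embed A (z *\<^sub>C u) = \<phi>)"

text \<open>An operator on \<open>\<complex>\<close> is identified with its value at \<open>1\<close>.\<close>

definition transfer_function ::
    "('a::chilbert_space \<times> 'a) set \<Rightarrow> ('a \<Rightarrow> 'a \<Rightarrow> complex) \<Rightarrow> (complex \<Rightarrow> 'a \<Rightarrow> complex)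
      \<Rightarrow> complex \<Rightarrow> complex" where
  "transfer_function A B K z = 1 - 2 * \<i> * K_adj K (bi_resolvent A B z (K 1))"

section \<open>Characteristic functions\<close>

definition hypothesis_H ::
    "('a::chilbert_space \<times> 'a) set \<Rightarrow> ('a \<times> 'a) set \<Rightarrow> ('a \<times> 'a) set \<Rightarrow> complex
      \<Rightarrow> 'a \<Rightarrow> 'a \<Rightarrow> bool" where
  "hypothesis_H A T A\<^sub>0 \<kappa> g\<^sub>p g\<^sub>m \<longleftrightarrow>
     T \<noteq> op_adjoint T \<and> maximal_dissipative_extension A T
     \<and> self_adjoint_operator A\<^sub>0 \<and> A \<subseteq> A\<^sub>0
     \<and> g\<^sub>p \<in> deficiency_space A \<i> \<and> norm g\<^sub>p = 1
     \<and> g\<^sub>m \<in> deficiency_space A (- \<i>) \<and> norm g\<^sub>m = 1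
     \<and> g\<^sub>p - g\<^sub>m \<in> Domain A\<^sub>0
     \<and> g\<^sub>p - \<kappa> *\<^sub>C g\<^sub>m \<in> Domain T
     \<and> cmod \<kappa> < 1"

text \<open>The deficiency spaces in the upper half-plane are one-dimensional, and the quotient is
  homogeneous of degree \<open>0\<close>, so the chosen \<open>g\<close> is immaterial.\<close>

definition livsic_function ::
    "('a::chilbert_space \<times> 'a) set \<Rightarrow> 'a \<Rightarrow> 'a \<Rightarrow> complex \<Rightarrow> complex" where
  "livsic_function A g\<^sub>p g\<^sub>m z =
     (let g = (SOME g. g \<in> deficiency_space A z \<and> g \<noteq> 0)
      in (z - \<i>) / (z + \<i>) * (cinner g g\<^sub>m / cinner g g\<^sub>p))"

definition characteristic_function ::
    "('a::chilbert_space \<times> 'a) set \<Rightarrow> complex \<Rightarrow> 'a \<Rightarrow> 'a \<Rightarrow> complex \<Rightarrow> complex" where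
  "characteristic_function A \<kappa> g\<^sub>p g\<^sub>m z =
     (livsic_function A g\<^sub>p g\<^sub>m z - \<kappa>) / (cnj \<kappa> * livsic_function A g\<^sub>p g\<^sub>m z - 1)"

abbreviation upper_half_plane :: "complex set" where
  "upper_half_plane \<equiv> {z. 0 < Im z}"

definition L_class :: "(complex \<Rightarrow> complex) set" where
  "L_class = {s. s holomorphic_on upper_half_plane
     \<and> s ` upper_half_plane \<subseteq> ball 0 1
     \<and> s \<i> = 0
     \<and> (\<forall>\<alpha> \<in> {0..<pi}. \<forall>\<epsilon> > 0.
          filterlim (\<lambda>z. z * (s z - exp (2 * \<i> * complex_of_real \<alpha>))) at_infinity
            (inf at_infinity (principal {z. z \<noteq> 0 \<and> \<epsilon> \<le> Arg z \<and> Arg z \<le> pi - \<epsilon>})))}"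

text \<open>Members are functions on the upper half-plane; their values elsewhere are arbitrary.\<close>

definition L_kappa_class :: "complex \<Rightarrow> (complex \<Rightarrow> complex) set" where
  "L_kappa_class \<kappa> = {S. \<exists>s \<in> L_class. \<forall>z \<in> upper_half_plane.
     S z = (s z - \<kappa>) / (cnj \<kappa> * s z - 1)}"

end

theory Submission
  imports Defs
begin

text \<open>Von Neumann's formula writes \<open>f\<close> in the domain of \<open>A\<^sup>*\<close> as an element of the domain of
  \<open>A\<close> plus \<open>cp f g\<^sub>p + cm f g\<^sub>m\<close>, and the boundary form \<open>(A\<^sup>* f, u) - (f, A\<^sup>* u)\<close> equals
  \<open>2 i (cp f \<cdot> cnj (cp u) - cm f \<cdot> cnj (cm u))\<close>. In these coordinates the domains of \<open>T\<close>, of its adjoint and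
  of the quasi-kernel are the lines \<open>cm + \<kappa> cp = 0\<close>, \<open>cp + \<kappa> cm = 0\<close> and \<open>cp + cm = 0\<close>, and this forces
  \<open>\<AA> f = A\<^sup>* f + (cm f + \<kappa> cp f) \<psi>\<close> with \<open>\<psi>\<close> the functional \<open>2 i (cp - cm) / (1 + \<kappa>)\<close>, while \<open>K 1\<close> is a
  multiple of \<open>cp - cm\<close>. For \<open>g\<close> in the deficiency space at \<open>z\<close> the Livsic function is
  \<open>s(z) = - cm g / cp g\<close>, and both the transfer function and \<open>1 / S\<close> become
  \<open>(cp g + \<kappa> cm g) / (cm g + \<kappa> cp g)\<close>.

  That \<open>s\<close> is of class \<open>\<LL>\<close> is seen, for each unimodular \<open>\<zeta>\<close>, from the resolvent \<open>R\<^sub>z\<close> of the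
  self-adjoint extension with domain \<open>cm + \<zeta> cp = 0\<close>: with \<open>g\<^sub>z = g\<^sub>p + (z - i) R\<^sub>z g\<^sub>p\<close> one has
  \<open>s(z) - \<zeta> = - 2 i \<zeta> / ((z + i) (g\<^sub>z, g\<^sub>p))\<close>, and \<open>g\<^sub>z\<close> tends to \<open>0\<close> in sectors.\<close>

section \<open>Hilbert spaces\<close>

lemma scaleC_zero_left [simp]: "0 *\<^sub>C (x::'a::chilbert_space) = 0"
  by (rule complex_vector.scale_zero_left)

lemma cinner_add_right: "cinner (x::'a::chilbert_space) (y + z) = cinner x y + cinner x z"
  by (metis cinner_add_left cinner_commute complex_cnj_add)

lemma cinner_scaleC_right: "cinner (x::'a::chilbert_space) (c *\<^sub>C y) = cnj c * cinner x y"
  by (metis cinner_commute cinner_scaleC_left complex_cnj_mult)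

lemma cinner_zero_left [simp]: "cinner 0 (x::'a::chilbert_space) = 0"
  using cinner_scaleC_left[of 0 x x] by simp

lemma cinner_zero_right [simp]: "cinner (x::'a::chilbert_space) 0 = 0"
  using cinner_scaleC_right[of x 0 x] by simp

lemma cinner_diff_left: "cinner (x - y) (z::'a::chilbert_space) = cinner x z - cinner y z"
  using cinner_add_left[of "x - y" y z] by simp

lemma cinner_diff_right: "cinner (x::'a::chilbert_space) (y - z) = cinner x y - cinner x z"
  using cinner_add_right[of x "y - z" z] by simp

lemma cinner_minus_left: "cinner (- x) (z::'a::chilbert_space) = - cinner x z"
  using cinner_diff_left[of 0 x z] by simp

lemma cinner_minus_right: "cinner (x::'a::chilbert_space) (- z) = - cinner x z"
  using cinner_diff_right[of x 0 z] by simp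

lemmas cinner_simps = cinner_add_left cinner_add_right cinner_diff_left cinner_diff_right
  cinner_scaleC_left cinner_scaleC_right cinner_minus_left cinner_minus_right

lemma norm_eq_Re_cinner: "(norm (x::'a::chilbert_space))\<^sup>2 = Re (cinner x x)"
  by (simp add: cinner_norm)

lemma norm_scaleC [simp]: "norm (c *\<^sub>C (x::'a::chilbert_space)) = cmod c * norm x"
proof -
  have "complex_of_real ((norm (c *\<^sub>C x))\<^sup>2) = c * cnj c * complex_of_real ((norm x)\<^sup>2)"
    unfolding cinner_norm[symmetric] by (simp add: cinner_simps)
  also have "\<dots> = complex_of_real ((cmod c * norm x)\<^sup>2)"
    by (simp add: complex_norm_square[symmetric] power_mult_distrib del: of_real_power)
  finally have "(norm (c *\<^sub>C x))\<^sup>2 = (cmod c * norm x)\<^sup>2"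
    by (simp only: of_real_eq_iff)
  then show ?thesis
    by (simp add: power2_eq_iff_nonneg)
qed

lemma Cauchy_Schwarz_cinner: "cmod (cinner x y) \<le> norm x * norm (y::'a::chilbert_space)"
proof (cases "y = 0")
  case False
  define c where "c = cinner x y / complex_of_real ((norm y)\<^sup>2)"
  have y: "complex_of_real ((norm y)\<^sup>2) \<noteq> 0"
    using False by simp
  have "cinner (x - c *\<^sub>C y) (x - c *\<^sub>C y)
      = cinner x x - cnj c * cinner x y - c * cinner y x + c * cnj c * cinner y y"
    by (simp add: cinner_simps algebra_simps)
  also have "c * cnj c * cinner y y = c * cinner y x"
    using y by (simp add: c_def cinner_norm cinner_commute[of y x] del: of_real_power)
  finally have "complex_of_real ((norm (x - c *\<^sub>C y))\<^sup>2)
      = complex_of_real ((norm x)\<^sup>2) - cinner x y * cnj (cinner x y) / complex_of_real ((norm y)\<^sup>2)"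
    by (simp add: cinner_norm c_def mult.commute cinner_commute[of y x])
  also have "\<dots> = complex_of_real ((norm x)\<^sup>2 - (cmod (cinner x y))\<^sup>2 / (norm y)\<^sup>2)"
    by (simp add: complex_norm_square[symmetric])
  finally have "(norm x)\<^sup>2 - (cmod (cinner x y))\<^sup>2 / (norm y)\<^sup>2 \<ge> 0"
    by (metis of_real_eq_iff zero_le_power2)
  then have "(cmod (cinner x y))\<^sup>2 \<le> (norm x * norm y)\<^sup>2"
    using False by (simp add: field_simps power_mult_distrib)
  then show ?thesis
    by (rule power2_le_imp_le) simp
qed simp

lemma bounded_bilinear_cinner:
  "bounded_bilinear (cinner :: 'a::chilbert_space \<Rightarrow> 'a \<Rightarrow> complex)"
proof
  show "\<exists>K. \<forall>a b::'a. cmod (cinner a b) \<le> norm a * norm b * K"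
    by (rule exI[of _ 1]) (simp add: Cauchy_Schwarz_cinner)
qed (simp_all add: cinner_simps scaleR_scaleC scaleR_conv_of_real)

lemmas continuous_on_cinner [continuous_intros] =
  bounded_bilinear.continuous_on[OF bounded_bilinear_cinner]

lemma bounded_linear_scaleC: "bounded_linear ((*\<^sub>C) c :: 'a::chilbert_space \<Rightarrow> 'a)"
proof
  show "\<exists>K. \<forall>x::'a. norm (c *\<^sub>C x) \<le> norm x * K"
    by (rule exI[of _ "cmod c"]) (simp add: mult.commute)
qed (simp_all add: scaleC_add_right scaleR_scaleC scaleC_scaleC mult.commute)

section \<open>Orthogonal projection onto closed subspaces\<close>

lemma parallelogram_law:
  "(norm (x + y))\<^sup>2 + (norm (x - y))\<^sup>2 = 2 * (norm x)\<^sup>2 + 2 * (norm (y::'a::chilbert_space))\<^sup>2"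
  by (simp add: norm_eq_Re_cinner cinner_simps)

text \<open>If \<open>cinner (y - m) v\<close> were nonzero, moving \<open>m\<close> by the
  projection of \<open>y - m\<close> on \<open>v\<close> would lower the squared distance to
  \<open>y\<close> by \<open>q > 0\<close>.\<close>

lemma closest_point_orthogonal:
  fixes M :: "'a::chilbert_space set"
  assumes scale: "\<And>c x. x \<in> M \<Longrightarrow> c *\<^sub>C x \<in> M"
    and add: "\<And>x y. x \<in> M \<Longrightarrow> y \<in> M \<Longrightarrow> x + y \<in> M"
    and m: "m \<in> M" and min: "\<And>x. x \<in> M \<Longrightarrow> norm (y - m) \<le> norm (y - x)"
    and v: "v \<in> M"
  shows "cinner (y - m) v = 0"
proof (cases "v = 0")
  case False
  define w where "w = y - m"
  define c where "c = cinner w v / complex_of_real ((norm v)\<^sup>2)"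
  define q where "q = (cmod (cinner w v))\<^sup>2 / (norm v)\<^sup>2"
  have nz: "complex_of_real ((norm v)\<^sup>2) \<noteq> 0"
    using False by simp
  have "norm w \<le> norm (w - c *\<^sub>C v)"
    using min[OF add[OF m scale[OF v, of c]]] by (simp add: w_def algebra_simps)
  then have le: "(norm w)\<^sup>2 \<le> (norm (w - c *\<^sub>C v))\<^sup>2"
    by (simp add: power_mono)
  have "cinner (w - c *\<^sub>C v) (w - c *\<^sub>C v)
      = cinner w w - cnj c * cinner w v - c * cinner v w + c * cnj c * cinner v v"
    by (simp add: cinner_simps algebra_simps)
  also have "c * cnj c * cinner v v = c * cinner v w"
    using nz by (simp add: c_def cinner_norm cinner_commute[of v w] del: of_real_power)
  also have "cnj c * cinner w v = complex_of_real q"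
    by (simp add: c_def q_def complex_norm_square[symmetric] mult.commute)
  finally have "(norm (w - c *\<^sub>C v))\<^sup>2 = (norm w)\<^sup>2 - q"
    unfolding norm_eq_Re_cinner by simp
  with le have "q \<le> 0" by linarith
  then show ?thesis
    using False by (simp add: q_def w_def field_simps)
qed simp

text \<open>A minimizing sequence is Cauchy: midpoints stay in \<open>M\<close>, so the
  parallelogram law bounds the distance of two terms by their excess over the infimum
  \<open>d\<close>. Its limit is a closest point.\<close>

lemma orthogonal_projection_exists:
  fixes M :: "'a::chilbert_space set"
  assumes clM: "closed M" and zero: "0 \<in> M"
    and scale: "\<And>c x. x \<in> M \<Longrightarrow> c *\<^sub>C x \<in> M"
    and add: "\<And>x y. x \<in> M \<Longrightarrow> y \<in> M \<Longrightarrow> x + y \<in> M"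
  obtains m where "m \<in> M" "\<And>v. v \<in> M \<Longrightarrow> cinner (y - m) v = 0"
proof -
  define d where "d = infdist y M"
  have d0: "0 \<le> d"
    by (simp add: d_def infdist_nonneg)
  have dle: "d \<le> norm (y - x)" if "x \<in> M" for x
    using infdist_le[OF that] by (simp add: d_def dist_norm)
  have "\<exists>x \<in> M. norm (y - x) < d + 1 / real (Suc n)" for n
  proof -
    have "d = (INF x\<in>M. dist y x)"
      unfolding d_def using zero by (intro infdist_notempty) auto
    then have "(INF x\<in>M. dist y x) < d + 1 / real (Suc n)"
      by (simp del: of_nat_Suc)
    moreover have "bdd_below (dist y ` M)"
      by (auto simp: bdd_below_def intro!: exI[of _ 0])
    ultimately show ?thesis
      using zero cINF_less_iff[of M "dist y"] by (auto simp: dist_norm)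
  qed
  then obtain x where xM: "\<And>n. x n \<in> M" and xd: "\<And>n. norm (y - x n) < d + 1 / real (Suc n)"
    by metis
  have lim: "(\<lambda>n. d + 1 / real (Suc n)) \<longlonglongrightarrow> d"
    using tendsto_add[OF tendsto_const LIMSEQ_Suc[OF lim_1_over_n], of d] by simp
  \<comment> \<open>The share of one term in the parallelogram law, after
    \<open>norm ((y - x n) + (y - x k)) \<ge> 2 * d\<close> has been subtracted in squared
    form.\<close>
  define p where "p n = 2 * ((d + 1 / real (Suc n))\<^sup>2 - d\<^sup>2)" for n
  have par: "(norm (x n - x k))\<^sup>2 \<le> p n + p k" for n k
  proof -
    have "(1/2::complex) *\<^sub>C (x n + x k) \<in> M"
      using xM add scale by blast
    from dle[OF this] have "d \<le> norm ((1/2::real) *\<^sub>R ((y - x n) + (y - x k)))"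
    proof -
      assume "d \<le> norm (y - (1/2::complex) *\<^sub>C (x n + x k))"
      moreover have "y - (1/2::complex) *\<^sub>C (x n + x k) = (1/2::real) *\<^sub>R ((y - x n) + (y - x k))"
      proof -
        have "(1/2::complex) *\<^sub>C (x n + x k) = (1/2::real) *\<^sub>R (x n + x k)"
          by (simp add: scaleR_scaleC)
        moreover have "y = (1/2::real) *\<^sub>R (y + y)"
          by (simp flip: scaleR_2)
        ultimately show ?thesis
          by (simp add: algebra_simps)
      qed
      ultimately show ?thesis by simp
    qed
    then have "2 * d \<le> norm ((y - x n) + (y - x k))"
      by simp
    then have "(2 * d)\<^sup>2 \<le> (norm ((y - x n) + (y - x k)))\<^sup>2"
      using d0 by (intro power_mono) auto
    moreover have "(norm (y - x n))\<^sup>2 \<le> (d + 1 / real (Suc n))\<^sup>2"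
      "(norm (y - x k))\<^sup>2 \<le> (d + 1 / real (Suc k))\<^sup>2"
      using xd less_imp_le by (auto intro!: power_mono simp del: of_nat_Suc)
    moreover have "norm (x n - x k) = norm ((y - x n) - (y - x k))"
      by (simp add: norm_minus_commute)
    ultimately show ?thesis
      using parallelogram_law[of "y - x n" "y - x k"]
      by (simp add: power_mult_distrib p_def del: of_nat_Suc)
  qed
  have "Cauchy x"
  proof (rule CauchyI)
    fix e :: real assume e: "0 < e"
    have "p \<longlonglongrightarrow> 2 * (d\<^sup>2 - d\<^sup>2)"
      unfolding p_def by (intro tendsto_intros lim)
    then have "p \<longlonglongrightarrow> 0" by simp
    from order_tendstoD(2)[OF this, of "e\<^sup>2 / 2"] e
    obtain N where N: "\<And>n. n \<ge> N \<Longrightarrow> p n < e\<^sup>2 / 2"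
      by (auto simp: eventually_sequentially)
    have "norm (x n - x k) < e" if "n \<ge> N" "k \<ge> N" for n k
    proof -
      have "(norm (x n - x k))\<^sup>2 < e\<^sup>2"
        using par[of n k] N[OF that(1)] N[OF that(2)] by linarith
      then show ?thesis
        using e by (auto dest: power2_less_imp_less)
    qed
    then show "\<exists>N. \<forall>n\<ge>N. \<forall>k\<ge>N. norm (x n - x k) < e" by blast
  qed
  then obtain m where m: "x \<longlonglongrightarrow> m"
    using Cauchy_convergent_iff convergent_def by blast
  have mM: "m \<in> M"
    using closed_sequentially[OF clM xM m] .
  have "norm (y - m) \<le> d"
  proof (rule LIMSEQ_le)
    show "(\<lambda>n. norm (y - x n)) \<longlonglongrightarrow> norm (y - m)"
      by (intro tendsto_intros m)
    show "(\<lambda>n. d + 1 / real (Suc n)) \<longlonglongrightarrow> d" by (rule lim)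
    show "\<exists>N. \<forall>n\<ge>N. norm (y - x n) \<le> d + 1 / real (Suc n)"
      using xd less_imp_le by blast
  qed
  then have "norm (y - m) \<le> norm (y - v)" if "v \<in> M" for v
    using dle[OF that] by simp
  from closest_point_orthogonal[OF scale add mM this]
  show ?thesis
    using mM that by blast
qed

section \<open>Closed symmetric operators\<close>

lemma linear_operatorD:
  assumes "linear_operator T"
  shows "single_valued T" "(0, 0) \<in> T"
    "(f, f') \<in> T \<Longrightarrow> (g, g') \<in> T \<Longrightarrow> (f + g, f' + g') \<in> T"
    "(f, f') \<in> T \<Longrightarrow> (c *\<^sub>C f, c *\<^sub>C f') \<in> T"
  using assms unfolding linear_operator_def by blast+

lemma linear_operator_diff:
  assumes "linear_operator T" "(f, f') \<in> T" "(g, g') \<in> T"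
  shows "(f - g, f' - g') \<in> T"
  using linear_operatorD(3)[OF assms(1,2) linear_operatorD(4)[OF assms(1,3), of "-1"]]
  by simp

lemma op_adjoint_iff: "(g, h) \<in> op_adjoint T \<longleftrightarrow> (\<forall>(f, f') \<in> T. cinner f' g = cinner f h)"
  by (simp add: op_adjoint_def)

lemma op_adjointD: "(g, h) \<in> op_adjoint T \<Longrightarrow> (f, f') \<in> T \<Longrightarrow> cinner f' g = cinner f h"
  by (auto simp: op_adjoint_def)

lemma op_adjoint_antimono: "S \<subseteq> T \<Longrightarrow> op_adjoint T \<subseteq> op_adjoint S"
  by (auto simp: op_adjoint_def)

lemma symmetric_subset_op_adjoint: "symmetric_operator T \<Longrightarrow> T \<subseteq> op_adjoint T"
  by (fastforce simp: symmetric_operator_def op_adjoint_def)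

lemma closed_op_adjoint: "closed (op_adjoint (T :: ('a::chilbert_space \<times> 'a) set))"
proof -
  have "op_adjoint T = (\<Inter>(f, f') \<in> T. {p. cinner f' (fst p) = cinner f (snd p)})"
    by (auto simp: op_adjoint_def)
  moreover have "closed {p :: 'a \<times> 'a. cinner f' (fst p) = cinner f (snd p)}" for f f' :: 'a
    by (intro closed_Collect_eq continuous_intros)
  ultimately show ?thesis
    by (auto intro!: closed_INT)
qed

text \<open>Density gives single-valuedness: two values at \<open>g\<close> differ by a vector
  orthogonal to the dense domain of \<open>T\<close>.\<close>

lemma linear_operator_op_adjoint:
  assumes "densely_defined T"
  shows "linear_operator (op_adjoint T)"
  unfolding linear_operator_def
proof (intro conjI)
  show "single_valued (op_adjoint T)"
  proof (rule single_valuedI)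
    fix g h k assume gh: "(g, h) \<in> op_adjoint T" and gk: "(g, k) \<in> op_adjoint T"
    have "cinner f (h - k) = 0" if "f \<in> Domain T" for f
      using that op_adjointD[OF gh] op_adjointD[OF gk] by (auto simp: cinner_simps)
    then have "Domain T \<subseteq> {f. cinner f (h - k) = 0}" by auto
    moreover have "closed {f. cinner f (h - k) = 0}"
      by (intro closed_Collect_eq continuous_intros)
    ultimately have "closure (Domain T) \<subseteq> {f. cinner f (h - k) = 0}"
      by (rule closure_minimal)
    then have "cinner (h - k) (h - k) = 0"
      using assms by (auto simp: densely_defined_def)
    then show "h = k"
      by (simp add: cinner_norm)
  qed
qed (fastforce simp: op_adjoint_def cinner_simps)+

text \<open>As \<open>(T f, f)\<close> is real, \<open>\<bar>Im z\<bar> \<parallel>f\<parallel>\<^sup>2\<close> is the modulus of the imaginary part of \<open>(T f - z f, f)\<close>.\<close>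

lemma symmetric_lower_bound:
  assumes "symmetric_operator T" "(f, f') \<in> T"
  shows "\<bar>Im z\<bar> * norm f \<le> norm (f' - z *\<^sub>C f)"
proof (cases "f = 0")
  case False
  have "cinner f' f = cinner f f'"
    using assms by (auto simp: symmetric_operator_def)
  then have "cinner f' f = cnj (cinner f' f)"
    by (rule trans) (rule cinner_commute)
  then have "Im (cinner f' f) = 0"
    by (simp add: complex_eq_iff)
  then have "Im (cinner (f' - z *\<^sub>C f) f) = - Im z * (norm f)\<^sup>2"
    by (simp add: cinner_simps cinner_norm del: of_real_power)
  then have "\<bar>Im z\<bar> * (norm f)\<^sup>2 \<le> cmod (cinner (f' - z *\<^sub>C f) f)"
    using abs_Im_le_cmod[of "cinner (f' - z *\<^sub>C f) f"] by (simp add: abs_mult)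
  also have "\<dots> \<le> norm (f' - z *\<^sub>C f) * norm f"
    by (rule Cauchy_Schwarz_cinner)
  finally show ?thesis
    using False by (simp add: power2_eq_square)
qed simp

text \<open>The set is the range of \<open>T - z\<close>. By \<open>symmetric_lower_bound\<close>,
  convergence of the images under \<open>T - z\<close> forces convergence of the arguments, and the
  graph is closed.\<close>

lemma closed_range_symmetric:
  fixes T :: "('a::chilbert_space \<times> 'a) set"
  assumes lin: "linear_operator T" and cl: "closed T" and sym: "symmetric_operator T"
    and z: "Im z \<noteq> 0"
  shows "closed {y. \<exists>f. (f, y + z *\<^sub>C f) \<in> T}"
  unfolding closed_sequential_limits
proof (intro allI impI, elim conjE)
  fix x :: "nat \<Rightarrow> 'a" and l
  assume "\<forall>n. x n \<in> {y. \<exists>f. (f, y + z *\<^sub>C f) \<in> T}" and l: "x \<longlonglongrightarrow> l"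
  then obtain f where f: "\<And>n. (f n, x n + z *\<^sub>C f n) \<in> T"
    by simp metis
  have b: "\<bar>Im z\<bar> * norm (f n - f k) \<le> norm (x n - x k)" for n k
    using symmetric_lower_bound[OF sym linear_operator_diff[OF lin f f], of z n k]
    by (simp add: complex_vector.scale_right_diff_distrib algebra_simps)
  have "Cauchy f"
  proof (rule CauchyI)
    fix e :: real assume "0 < e"
    then have "0 < \<bar>Im z\<bar> * e" using z by simp
    with LIMSEQ_imp_Cauchy[OF l] obtain N
      where N: "\<forall>n\<ge>N. \<forall>k\<ge>N. norm (x n - x k) < \<bar>Im z\<bar> * e"
      by (meson CauchyD)
    have "norm (f n - f k) < e" if "n \<ge> N" "k \<ge> N" for n k
    proof -
      have "\<bar>Im z\<bar> * norm (f n - f k) < \<bar>Im z\<bar> * e"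
        using N b[of n k] that by fastforce
      then show ?thesis using z by simp
    qed
    then show "\<exists>N. \<forall>n\<ge>N. \<forall>k\<ge>N. norm (f n - f k) < e" by blast
  qed
  then obtain g where g: "f \<longlonglongrightarrow> g"
    using Cauchy_convergent_iff convergent_def by blast
  have "(\<lambda>n. (f n, x n + z *\<^sub>C f n)) \<longlonglongrightarrow> (g, l + z *\<^sub>C g)"
    by (intro tendsto_Pair tendsto_add g l bounded_linear.tendsto[OF bounded_linear_scaleC])
  from closed_sequentially[OF cl f this] show "l \<in> {y. \<exists>f. (f, y + z *\<^sub>C f) \<in> T}"
    by auto
qed

text \<open>The orthogonal complement of the range of \<open>T - z\<close> is the deficiency space
  at \<open>cnj z\<close>. Projecting \<open>y\<close> onto the closed range leaves a residue in
  that space, which vanishes because \<open>y\<close> is orthogonal to it.\<close>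

lemma range_symmetric:
  fixes T :: "('a::chilbert_space \<times> 'a) set"
  assumes lin: "linear_operator T" and cl: "closed T" and sym: "symmetric_operator T"
    and z: "Im z \<noteq> 0"
    and orth: "\<And>g. g \<in> deficiency_space T (cnj z) \<Longrightarrow> cinner y g = 0"
  shows "\<exists>f. (f, y + z *\<^sub>C f) \<in> T"
proof -
  define M where "M = {y. \<exists>f. (f, y + z *\<^sub>C f) \<in> T}"
  have M0: "0 \<in> M"
    using linear_operatorD(2)[OF lin] by (auto simp: M_def intro!: exI[of _ 0])
  have Ms: "c *\<^sub>C x \<in> M" if x: "x \<in> M" for c x
  proof -
    from x obtain f where f: "(f, x + z *\<^sub>C f) \<in> T"
      by (auto simp: M_def)
    show ?thesis
      using linear_operatorD(4)[OF lin f, of c]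
      by (auto simp: M_def scaleC_add_right scaleC_scaleC mult.commute intro!: exI[of _ "c *\<^sub>C f"])
  qed
  have Ma: "x + x' \<in> M" if x: "x \<in> M" "x' \<in> M" for x x'
  proof -
    from x obtain f f' where f: "(f, x + z *\<^sub>C f) \<in> T" "(f', x' + z *\<^sub>C f') \<in> T"
      by (auto simp: M_def)
    show ?thesis
      using linear_operatorD(3)[OF lin f]
      by (auto simp: M_def scaleC_add_right algebra_simps intro!: exI[of _ "f + f'"])
  qed
  obtain m where m: "m \<in> M" and om: "\<And>v. v \<in> M \<Longrightarrow> cinner (y - m) v = 0"
    using orthogonal_projection_exists[OF _ M0 Ms Ma] closed_range_symmetric[OF lin cl sym z]
    unfolding M_def by blast
  define w where "w = y - m"
  have "(w, cnj z *\<^sub>C w) \<in> op_adjoint T"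
    unfolding op_adjoint_iff
  proof safe
    fix f f' assume f: "(f, f') \<in> T"
    then have "f' - z *\<^sub>C f \<in> M"
      by (auto simp: M_def intro!: exI[of _ f])
    then have "cinner (f' - z *\<^sub>C f) w = 0"
      using om cinner_commute[of _ w] by (simp add: w_def)
    then show "cinner f' w = cinner f (cnj z *\<^sub>C w)"
      by (simp add: cinner_simps)
  qed
  then have "cinner y w = 0"
    using orth by (simp add: deficiency_space_def)
  moreover have "cinner m w = 0"
    using om[OF m] cinner_commute[of m w] by (simp add: w_def)
  ultimately have "cinner w w = 0"
    by (simp add: w_def cinner_simps)
  then have "y = m"
    by (simp add: cinner_norm w_def)
  then show ?thesis
    using m by (simp add: M_def)
qed

section \<open>Resolvents of self-adjoint operators\<close>

definition op_resolvent :: "('a::chilbert_space \<times> 'a) set \<Rightarrow> complex \<Rightarrow> 'a \<Rightarrow> 'a" where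
  "op_resolvent T z y = (SOME f. (f, y + z *\<^sub>C f) \<in> T)"

lemma self_adjoint_symmetric: "self_adjoint_operator T \<Longrightarrow> symmetric_operator T"
  by (fastforce simp: self_adjoint_operator_def symmetric_operator_def op_adjoint_def)

text \<open>A deficiency vector of a self-adjoint operator at \<open>cnj z\<close> is an eigenvector
  for a nonreal number, hence zero; so \<open>T - z\<close> is onto.\<close>

lemma op_resolvent_mem:
  fixes T :: "('a::chilbert_space \<times> 'a) set"
  assumes sa: "self_adjoint_operator T" and z: "Im z \<noteq> 0"
  shows "(op_resolvent T z y, y + z *\<^sub>C op_resolvent T z y) \<in> T"
  unfolding op_resolvent_def
proof (rule someI_ex, rule range_symmetric)
  show "linear_operator T" "closed T" "symmetric_operator T" "Im z \<noteq> 0"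
    using sa z closed_op_adjoint[of T] self_adjoint_symmetric
    by (auto simp: self_adjoint_operator_def)
  fix g assume "g \<in> deficiency_space T (cnj z)"
  then have "(g, cnj z *\<^sub>C g) \<in> T"
    using sa by (simp add: deficiency_space_def self_adjoint_operator_def)
  from symmetric_lower_bound[OF self_adjoint_symmetric[OF sa] this, of "cnj z"] z
  show "cinner y g = 0"
    by (simp add: mult_le_0_iff)
qed

lemma op_resolvent_unique:
  assumes sa: "self_adjoint_operator T" and z: "Im z \<noteq> 0" and f: "(f, y + z *\<^sub>C f) \<in> T"
  shows "op_resolvent T z y = f"
proof -
  have "linear_operator T" using sa by (simp add: self_adjoint_operator_def)
  from linear_operator_diff[OF this op_resolvent_mem[OF sa z, of y] f]
  have "(op_resolvent T z y - f, z *\<^sub>C (op_resolvent T z y - f)) \<in> T"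
    by (simp add: complex_vector.scale_right_diff_distrib)
  from symmetric_lower_bound[OF self_adjoint_symmetric[OF sa] this, of z] z show ?thesis
    by (simp add: mult_le_0_iff)
qed

lemma norm_op_resolvent_le:
  assumes "self_adjoint_operator T" "Im z \<noteq> 0"
  shows "\<bar>Im z\<bar> * norm (op_resolvent T z y) \<le> norm y"
  using symmetric_lower_bound[OF self_adjoint_symmetric op_resolvent_mem[OF assms], of z y] assms
  by simp

lemma op_resolvent_diff:
  assumes sa: "self_adjoint_operator T" and z: "Im z \<noteq> 0"
  shows "op_resolvent T z (x - y) = op_resolvent T z x - op_resolvent T z y"
proof (rule op_resolvent_unique[OF sa z])
  have "linear_operator T" using sa by (simp add: self_adjoint_operator_def)
  from linear_operator_diff[OF this op_resolvent_mem[OF sa z, of x] op_resolvent_mem[OF sa z, of y]]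
  show "(op_resolvent T z x - op_resolvent T z y,
      x - y + z *\<^sub>C (op_resolvent T z x - op_resolvent T z y)) \<in> T"
    by (simp add: complex_vector.scale_right_diff_distrib algebra_simps)
qed

lemma resolvent_identity:
  assumes sa: "self_adjoint_operator T" and z: "Im z \<noteq> 0" and w: "Im w \<noteq> 0"
  shows "op_resolvent T z x - op_resolvent T w x = (z - w) *\<^sub>C op_resolvent T z (op_resolvent T w x)"
proof -
  have lin: "linear_operator T" using sa by (simp add: self_adjoint_operator_def)
  define f where "f = op_resolvent T w x"
  define g where "g = op_resolvent T z f"
  have "(f + (z - w) *\<^sub>C g, (x + w *\<^sub>C f) + (z - w) *\<^sub>C (f + z *\<^sub>C g)) \<in> T"
    by (intro linear_operatorD(3,4)[OF lin]) (simp_all add: f_def g_def op_resolvent_mem[OF sa] z w)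
  moreover have "(x + w *\<^sub>C f) + (z - w) *\<^sub>C (f + z *\<^sub>C g) = x + z *\<^sub>C (f + (z - w) *\<^sub>C g)"
    by (simp add: scaleC_add_right scaleC_scaleC complex_vector.scale_left_diff_distrib algebra_simps)
  ultimately have "op_resolvent T z x = f + (z - w) *\<^sub>C g"
    using op_resolvent_unique[OF sa z] by simp
  then show ?thesis
    by (simp add: f_def g_def)
qed

text \<open>Two uses of the resolvent identity show that the difference quotient at \<open>w\<close>
  differs from its limit by \<open>z - w\<close> times an inner product that stays bounded near
  \<open>w\<close>.\<close>

lemma holomorphic_cinner_op_resolvent:
  fixes x y :: "'a::chilbert_space"
  assumes sa: "self_adjoint_operator T"
  shows "(\<lambda>z. cinner (op_resolvent T z x) y) holomorphic_on {z. 0 < Im z}"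
proof (rule holomorphic_onI)
  fix w assume "w \<in> {z. 0 < Im z}"
  then have w: "0 < Im w" by simp
  let ?R = "op_resolvent T"
  \<comment> \<open>Near \<open>w\<close> one has \<open>Im z > Im w / 2\<close>, so the resolvent
    at \<open>z\<close> has norm at most \<open>2 / Im w\<close>.\<close>
  define C where "C = norm (?R w (?R w x)) * norm y / (Im w / 2)"
  have ev: "eventually (\<lambda>z. Im w / 2 < Im z) (at w)"
    using w order_tendstoD(1)[OF tendsto_Im[OF tendsto_ident_at[of w UNIV]], of "Im w / 2"] by simp
  have bd: "cmod ((cinner (?R z x) y - cinner (?R w x) y) / (z - w) - cinner (?R w (?R w x)) y)
      \<le> C * cmod (z - w)" if z: "Im w / 2 < Im z" "z \<noteq> w" for z
  proof -
    have z0: "0 < Im z" using z w by simp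
    define h where "h = ?R z (?R w (?R w x))"
    have "(cinner (?R z x) y - cinner (?R w x) y) / (z - w) = cinner (?R z (?R w x)) y"
      using resolvent_identity[OF sa, of z w x] z0 w z
      by (simp add: cinner_diff_left[symmetric] cinner_scaleC_left)
    then have "(cinner (?R z x) y - cinner (?R w x) y) / (z - w) - cinner (?R w (?R w x)) y
        = (z - w) * cinner h y"
      using resolvent_identity[OF sa, of z w "?R w x"] z0 w
      by (simp add: cinner_diff_left[symmetric] cinner_scaleC_left h_def)
    moreover have "Im w / 2 * norm h \<le> norm (?R w (?R w x))"
    proof -
      have "Im w / 2 * norm h \<le> \<bar>Im z\<bar> * norm h"
        using z by (intro mult_right_mono) auto
      also have "\<dots> \<le> norm (?R w (?R w x))"
        using norm_op_resolvent_le[OF sa, of z] z0 by (simp add: h_def)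
      finally show ?thesis .
    qed
    from mult_right_mono[OF this norm_ge_zero[of y]] have "norm h * norm y \<le> C"
      using w by (simp add: C_def field_simps)
    then have "cmod (cinner h y) \<le> C"
      using Cauchy_Schwarz_cinner[of h y] by linarith
    ultimately show ?thesis
      by (simp add: norm_mult mult.commute mult_right_mono)
  qed
  have "((\<lambda>z. (cinner (?R z x) y - cinner (?R w x) y) / (z - w) - cinner (?R w (?R w x)) y)
      \<longlongrightarrow> 0) (at w)"
  proof (rule Lim_null_comparison)
    show "eventually (\<lambda>z. cmod ((cinner (?R z x) y - cinner (?R w x) y) / (z - w)
        - cinner (?R w (?R w x)) y) \<le> C * cmod (z - w)) (at w)"
      using ev eventually_at_in_open'[OF open_UNIV UNIV_I, of w] eventually_neq_at_within[of w w UNIV]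
      by eventually_elim (rule bd)
    have "((\<lambda>z. C * cmod (z - w)) \<longlongrightarrow> C * cmod (w - w)) (at w)"
      by (intro tendsto_intros)
    then show "((\<lambda>z. C * cmod (z - w)) \<longlongrightarrow> 0) (at w)" by simp
  qed
  then have "((\<lambda>z. cinner (?R z x) y) has_field_derivative cinner (?R w (?R w x)) y) (at w)"
    unfolding has_field_derivative_iff by (subst Lim_null)
  then show "(\<lambda>z. cinner (?R z x) y) field_differentiable at w within {z. 0 < Im z}"
    using field_differentiable_at_within field_differentiable_def by blast
qed

section \<open>Symmetric operators with deficiency indices (1,1)\<close>

text \<open>A basis with \<open>card B = 1\<close> is a singleton, so \<open>u\<close> and
  \<open>v\<close> are multiples of the same vector.\<close>

lemma one_dimensional_multiple:
  fixes V :: "'a::chilbert_space set"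
  assumes dim: "complex_vector.dim V = 1" and v: "v \<in> V" "v \<noteq> 0" and u: "u \<in> V"
  shows "\<exists>c. u = c *\<^sub>C v"
proof -
  obtain B where B: "V \<subseteq> complex_vector.span B" "card B = complex_vector.dim V"
    using complex_vector.basis_exists by blast
  then obtain b where "B = {b}"
    using dim by (auto simp: card_1_singleton_iff)
  then have "V \<subseteq> range (\<lambda>k. k *\<^sub>C b)"
    using B(1) by (simp add: complex_vector.span_singleton)
  with u v obtain k l where k: "v = k *\<^sub>C b" and l: "u = l *\<^sub>C b"
    by blast
  moreover from k have "k \<noteq> 0"
    using v(2) by auto
  ultimately have "u = (l / k) *\<^sub>C v"
    by (simp add: scaleC_scaleC)
  then show ?thesis ..
qed

section \<open>Von Neumann's decomposition and the boundary form\<close>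

locale symmetric_1_1 =
  fixes A :: "('a::chilbert_space \<times> 'a) set" and g\<^sub>p g\<^sub>m :: 'a
  assumes lin: "linear_operator A" and cl: "closed A" and dense: "densely_defined A"
    and sym: "symmetric_operator A" and def_1_1: "deficiency_indices_1_1 A"
    and gp: "g\<^sub>p \<in> deficiency_space A \<i>" "norm g\<^sub>p = 1"
    and gm: "g\<^sub>m \<in> deficiency_space A (- \<i>)" "norm g\<^sub>m = 1"
begin

definition Ast :: "'a \<Rightarrow> 'a" where
  "Ast f = apply_op (op_adjoint A) f"

lemma lin_adjoint: "linear_operator (op_adjoint A)"
  by (rule linear_operator_op_adjoint[OF dense])

lemma Ast_eq: "(f, h) \<in> op_adjoint A \<Longrightarrow> Ast f = h"
  unfolding Ast_def apply_op_def
  using linear_operatorD(1)[OF lin_adjoint] by (blast dest: single_valuedD)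

lemma hplus_iff: "f \<in> hplus A \<longleftrightarrow> (f, Ast f) \<in> op_adjoint A"
  unfolding hplus_def using Ast_eq by auto

lemma hplusI: "(f, h) \<in> op_adjoint A \<Longrightarrow> f \<in> hplus A"
  unfolding hplus_def by auto

lemma
  assumes "f \<in> hplus A" "u \<in> hplus A"
  shows hplus_add: "f + u \<in> hplus A" and Ast_add: "Ast (f + u) = Ast f + Ast u"
  using linear_operatorD(3)[OF lin_adjoint] assms hplus_iff hplusI Ast_eq by metis+

lemma
  assumes "f \<in> hplus A" "u \<in> hplus A"
  shows hplus_diff: "f - u \<in> hplus A" and Ast_diff: "Ast (f - u) = Ast f - Ast u"
  using linear_operator_diff[OF lin_adjoint] assms hplus_iff hplusI Ast_eq by metis+

lemma
  assumes "f \<in> hplus A"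
  shows hplus_scale: "c *\<^sub>C f \<in> hplus A" and Ast_scale: "Ast (c *\<^sub>C f) = c *\<^sub>C Ast f"
  using linear_operatorD(4)[OF lin_adjoint] assms hplus_iff hplusI Ast_eq by metis+

lemma subset_adjoint: "A \<subseteq> op_adjoint A"
  by (rule symmetric_subset_op_adjoint[OF sym])

lemma deficiency_space_iff: "g \<in> deficiency_space A z \<longleftrightarrow> g \<in> hplus A \<and> Ast g = z *\<^sub>C g"
  unfolding deficiency_space_def using hplus_iff hplusI Ast_eq by auto

lemma gp_hplus [simp]: "g\<^sub>p \<in> hplus A" and Ast_gp: "Ast g\<^sub>p = \<i> *\<^sub>C g\<^sub>p"
  using gp(1) by (simp_all add: deficiency_space_iff)

lemma gm_hplus [simp]: "g\<^sub>m \<in> hplus A" and Ast_gm: "Ast g\<^sub>m = (- \<i>) *\<^sub>C g\<^sub>m"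
  using gm(1) by (simp_all add: deficiency_space_iff)

lemma cinner_gp_gp [simp]: "cinner g\<^sub>p g\<^sub>p = 1" and cinner_gm_gm [simp]: "cinner g\<^sub>m g\<^sub>m = 1"
  using gp(2) gm(2) by (simp_all add: cinner_norm)

text \<open>The coordinates of \<open>f\<close> along \<open>g\<^sub>p\<close> and \<open>g\<^sub>m\<close> in von Neumann's decomposition, read off from
  the boundary form \<open>(A\<^sup>* f, u) - (f, A\<^sup>* u)\<close> with \<open>u = g\<^sub>p\<close> and \<open>u = g\<^sub>m\<close>.\<close>

definition cp :: "'a \<Rightarrow> complex" where
  "cp f = (cinner (Ast f) g\<^sub>p + \<i> * cinner f g\<^sub>p) / (2 * \<i>)"

definition cm :: "'a \<Rightarrow> complex" where
  "cm f = - (cinner (Ast f) g\<^sub>m - \<i> * cinner f g\<^sub>m) / (2 * \<i>)"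

lemma cp_add: "f \<in> hplus A \<Longrightarrow> u \<in> hplus A \<Longrightarrow> cp (f + u) = cp f + cp u"
  and cm_add: "f \<in> hplus A \<Longrightarrow> u \<in> hplus A \<Longrightarrow> cm (f + u) = cm f + cm u"
  and cp_diff: "f \<in> hplus A \<Longrightarrow> u \<in> hplus A \<Longrightarrow> cp (f - u) = cp f - cp u"
  and cm_diff: "f \<in> hplus A \<Longrightarrow> u \<in> hplus A \<Longrightarrow> cm (f - u) = cm f - cm u"
  and cp_scale: "f \<in> hplus A \<Longrightarrow> cp (c *\<^sub>C f) = c * cp f"
  and cm_scale: "f \<in> hplus A \<Longrightarrow> cm (c *\<^sub>C f) = c * cm f"
  by (simp_all add: cp_def cm_def Ast_add Ast_diff Ast_scale cinner_simps field_simps)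

lemmas coord_simps = cp_add cm_add cp_diff cm_diff cp_scale cm_scale
  hplus_add hplus_diff hplus_scale

lemma coord_g [simp]: "cp g\<^sub>p = 1" "cm g\<^sub>p = 0" "cp g\<^sub>m = 0" "cm g\<^sub>m = 1"
  by (simp_all add: cp_def cm_def Ast_gp Ast_gm cinner_simps)

lemma
  assumes "(h, h') \<in> A"
  shows Domain_hplus: "h \<in> hplus A" and Ast_Domain: "Ast h = h'"
    and cp_Domain: "cp h = 0" and cm_Domain: "cm h = 0"
proof -
  show h: "h \<in> hplus A" "Ast h = h'"
    using assms subset_adjoint hplusI Ast_eq by auto
  have "cinner h' g\<^sub>p = cinner h (\<i> *\<^sub>C g\<^sub>p)" "cinner h' g\<^sub>m = cinner h ((- \<i>) *\<^sub>C g\<^sub>m)"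
    using gp(1) gm(1) assms op_adjointD unfolding deficiency_space_def by blast+
  then show "cp h = 0" "cm h = 0"
    by (simp_all add: cp_def cm_def h cinner_simps)
qed

lemma gp_nonzero: "g\<^sub>p \<noteq> 0" and gm_nonzero: "g\<^sub>m \<noteq> 0"
  using gp(2) gm(2) by auto

lemma deficiency_i_multiple: "g \<in> deficiency_space A \<i> \<Longrightarrow> \<exists>c. g = c *\<^sub>C g\<^sub>p"
  using def_1_1 gp gp_nonzero one_dimensional_multiple[of "deficiency_space A \<i>" g\<^sub>p g]
  by (auto simp: deficiency_indices_1_1_def)

lemma deficiency_minus_i_multiple: "g \<in> deficiency_space A (- \<i>) \<Longrightarrow> \<exists>c. g = c *\<^sub>C g\<^sub>m"
  using def_1_1 gm gm_nonzero one_dimensional_multiple[of "deficiency_space A (- \<i>)" g\<^sub>m g]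
  by (auto simp: deficiency_indices_1_1_def)

text \<open>After subtracting a multiple of \<open>g\<^sub>m\<close>, the vector \<open>(A\<^sup>* - i) f\<close> is orthogonal to
  \<open>g\<^sub>m\<close>, hence in the range of \<open>A - i\<close>; what remains lies in the deficiency space of \<open>g\<^sub>p\<close>.\<close>

lemma von_Neumann_decomposition:
  assumes f: "f \<in> hplus A"
  obtains h h' where "(h, h') \<in> A" "f = h + cp f *\<^sub>C g\<^sub>p + cm f *\<^sub>C g\<^sub>m"
proof -
  \<comment> \<open>The adjoint of \<open>A\<close> minus \<open>\<i>\<close> multiplies
    \<open>g\<^sub>m\<close> by \<open>- 2 * \<i>\<close>, so this is the coefficient that makes
    \<open>y\<close> orthogonal to \<open>g\<^sub>m\<close>.\<close>
  define b where "b = cinner (Ast f - \<i> *\<^sub>C f) g\<^sub>m / (- 2 * \<i>)"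
  define f1 where "f1 = f - b *\<^sub>C g\<^sub>m"
  have f1: "f1 \<in> hplus A"
    by (simp add: f1_def f hplus_diff hplus_scale)
  define y where "y = Ast f1 - \<i> *\<^sub>C f1"
  have Af1: "Ast f1 = Ast f + (\<i> * b) *\<^sub>C g\<^sub>m"
    by (simp add: f1_def Ast_diff f hplus_scale Ast_scale Ast_gm scaleC_scaleC
        complex_vector.scale_minus_left mult.commute)
  have y: "cinner y g\<^sub>m = 0"
    unfolding y_def Af1 unfolding f1_def b_def by (simp add: cinner_simps field_simps)
  have "\<exists>h. (h, y + \<i> *\<^sub>C h) \<in> A"
  proof (rule range_symmetric[OF lin cl sym])
    fix g assume "g \<in> deficiency_space A (cnj \<i>)"
    then obtain c where "g = c *\<^sub>C g\<^sub>m"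
      using deficiency_minus_i_multiple by auto
    then show "cinner y g = 0"
      by (simp add: cinner_scaleC_right y)
  qed simp
  then obtain h where h: "(h, y + \<i> *\<^sub>C h) \<in> A" by blast
  note h' = Domain_hplus[OF h] Ast_Domain[OF h] cp_Domain[OF h] cm_Domain[OF h]
  have "f1 - h \<in> deficiency_space A \<i>"
    by (simp add: deficiency_space_iff hplus_diff f1 h' Ast_diff y_def
        complex_vector.scale_right_diff_distrib)
  then obtain a where "f1 - h = a *\<^sub>C g\<^sub>p"
    using deficiency_i_multiple by blast
  then have eq: "f = h + a *\<^sub>C g\<^sub>p + b *\<^sub>C g\<^sub>m"
    by (simp add: f1_def algebra_simps)
  have "cp f = a" "cm f = b"
    by (simp_all add: eq coord_simps h')
  with eq h show ?thesis
    by (intro that) simp_all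
qed

text \<open>Only \<open>u\<close> is decomposed: its part \<open>h\<close> in the domain of
  \<open>A\<close> cancels by definition of the adjoint, and the pairings of \<open>f\<close> with
  \<open>g\<^sub>p\<close> and \<open>g\<^sub>m\<close> are those that define \<open>cp f\<close>
  and \<open>cm f\<close>.\<close>

lemma boundary_form:
  assumes f: "f \<in> hplus A" and u: "u \<in> hplus A"
  shows "cinner (Ast f) u - cinner f (Ast u) = 2 * \<i> * (cp f * cnj (cp u) - cm f * cnj (cm u))"
proof -
  obtain h h' where h: "(h, h') \<in> A" and eq: "u = h + cp u *\<^sub>C g\<^sub>p + cm u *\<^sub>C g\<^sub>m"
    using von_Neumann_decomposition[OF u] by blast
  note h' = Domain_hplus[OF h] Ast_Domain[OF h]
  have "cinner h' f = cinner h (Ast f)"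
    using f h by (auto simp: hplus_iff intro: op_adjointD)
  then have hf: "cinner (Ast f) h = cinner f h'"
    by (metis cinner_commute)
  have Au: "Ast u = h' + (\<i> * cp u) *\<^sub>C g\<^sub>p + (- \<i> * cm u) *\<^sub>C g\<^sub>m"
    by (subst eq) (simp add: Ast_add Ast_scale hplus_add hplus_scale h' Ast_gp Ast_gm
        scaleC_scaleC complex_vector.scale_minus_left mult.commute)
  have cpf: "cinner (Ast f) g\<^sub>p = 2 * \<i> * cp f - \<i> * cinner f g\<^sub>p"
    and cmf: "cinner (Ast f) g\<^sub>m = \<i> * cinner f g\<^sub>m - 2 * \<i> * cm f"
    by (simp_all add: cp_def cm_def)
  have left: "cinner (Ast f) u = cinner f h' + cnj (cp u) * (2 * \<i> * cp f - \<i> * cinner f g\<^sub>p)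
      + cnj (cm u) * (\<i> * cinner f g\<^sub>m - 2 * \<i> * cm f)"
    by (subst eq) (simp add: cinner_add_right cinner_scaleC_right hf cpf cmf)
  have right: "cinner f (Ast u) = cinner f h' - \<i> * cnj (cp u) * cinner f g\<^sub>p
      + \<i> * cnj (cm u) * cinner f g\<^sub>m"
    unfolding Au by (simp add: cinner_simps)
  show ?thesis
    unfolding left right by (simp add: algebra_simps)
qed

text \<open>The first equation is the boundary form of \<open>g\<close> with itself; the other two
  translate the inner products in the Livsic quotient into coordinates.\<close>

lemma deficiency_coords:
  assumes g: "g \<in> deficiency_space A z"
  shows "Im z * (norm g)\<^sup>2 = (cmod (cp g))\<^sup>2 - (cmod (cm g))\<^sup>2"
    and "(z + \<i>) * cinner g g\<^sub>p = 2 * \<i> * cp g"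
    and "(z - \<i>) * cinner g g\<^sub>m = - 2 * \<i> * cm g"
proof -
  have g': "g \<in> hplus A" "Ast g = z *\<^sub>C g"
    using g by (simp_all add: deficiency_space_iff)
  have "(z - cnj z) * cinner g g = 2 * \<i> * (cp g * cnj (cp g) - cm g * cnj (cm g))"
    using boundary_form[OF g'(1) g'(1)] by (simp add: g'(2) cinner_simps algebra_simps)
  then have "2 * \<i> * complex_of_real (Im z * (norm g)\<^sup>2)
      = 2 * \<i> * complex_of_real ((cmod (cp g))\<^sup>2 - (cmod (cm g))\<^sup>2)"
    by (simp add: complex_diff_cnj complex_norm_square[symmetric] cinner_norm del: of_real_power)
  then show "Im z * (norm g)\<^sup>2 = (cmod (cp g))\<^sup>2 - (cmod (cm g))\<^sup>2"
    by (simp del: of_real_power of_real_mult of_real_diff)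
  have "2 * \<i> * cp g = cinner (Ast g) g\<^sub>p + \<i> * cinner g g\<^sub>p"
    "- 2 * \<i> * cm g = cinner (Ast g) g\<^sub>m - \<i> * cinner g g\<^sub>m"
    by (simp_all add: cp_def cm_def)
  then show "(z + \<i>) * cinner g g\<^sub>p = 2 * \<i> * cp g" "(z - \<i>) * cinner g g\<^sub>m = - 2 * \<i> * cm g"
    by (simp_all add: g' cinner_scaleC_left algebra_simps)
qed

lemma deficiency_coord_less:
  assumes "g \<in> deficiency_space A z" "g \<noteq> 0" "0 < Im z"
  shows "cmod (cm g) < cmod (cp g)"
proof -
  have "0 < Im z * (norm g)\<^sup>2"
    using assms by simp
  then have "(cmod (cm g))\<^sup>2 < (cmod (cp g))\<^sup>2"
    using deficiency_coords(1)[OF assms(1)] by simp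
  then show ?thesis
    by (rule power2_less_imp_less) simp
qed

text \<open>The combination \<open>w\<close> stays in the deficiency space and has
  \<open>cp w = 0\<close>, so \<open>deficiency_coord_less\<close> forces
  \<open>w = 0\<close>.\<close>

lemma deficiency_space_proportional:
  assumes g: "g \<in> deficiency_space A z" and u: "u \<in> deficiency_space A z" and z: "0 < Im z"
  shows "cm g * cp u = cm u * cp g"
proof -
  have h: "g \<in> hplus A" "u \<in> hplus A"
    using g u by (simp_all add: deficiency_space_iff)
  define w where "w = cp u *\<^sub>C g - cp g *\<^sub>C u"
  have "w \<in> deficiency_space A z"
    using g u by (simp add: deficiency_space_iff w_def coord_simps Ast_diff Ast_scale
        scaleC_scaleC complex_vector.scale_right_diff_distrib mult.commute)
  moreover have "cp w = 0"
    by (simp add: w_def coord_simps h)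
  ultimately have "w = 0"
    using deficiency_coord_less[of w z] z by fastforce
  moreover have "cm w = cp u * cm g - cp g * cm u"
    by (simp add: w_def coord_simps h)
  moreover have "cm 0 = 0"
    using cm_diff[OF gp_hplus gp_hplus] by simp
  ultimately show ?thesis
    by (simp add: mult.commute)
qed

text \<open>Self-adjoint only for unimodular \<open>\<zeta>\<close>; the domain is spanned by that of \<open>A\<close> and \<open>g\<^sub>p - \<zeta> g\<^sub>m\<close>.\<close>

definition ext :: "complex \<Rightarrow> ('a \<times> 'a) set" where
  "ext \<zeta> = {(f, h). (f, h) \<in> op_adjoint A \<and> cm f + \<zeta> * cp f = 0}"

lemma ext_iff: "(f, h) \<in> ext \<zeta> \<longleftrightarrow> f \<in> hplus A \<and> h = Ast f \<and> cm f + \<zeta> * cp f = 0"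
  unfolding ext_def using hplus_iff hplusI Ast_eq by auto

lemma subset_ext: "A \<subseteq> ext \<zeta>"
  by (auto simp: ext_iff Domain_hplus Ast_Domain cp_Domain cm_Domain)

lemma linear_ext: "linear_operator (ext \<zeta>)"
  unfolding linear_operator_def
proof (intro conjI)
  show "single_valued (ext \<zeta>)"
    by (rule single_valuedI) (simp add: ext_iff)
  show "(0, 0) \<in> ext \<zeta>"
    using linear_operatorD(2)[OF lin] subset_ext by blast
  show "\<forall>(f, f')\<in>ext \<zeta>. \<forall>(g, g')\<in>ext \<zeta>. (f + g, f' + g') \<in> ext \<zeta>"
    by (auto simp: ext_iff coord_simps Ast_add) (simp add: algebra_simps)
  show "\<forall>c. \<forall>(f, f')\<in>ext \<zeta>. (c *\<^sub>C f, c *\<^sub>C f') \<in> ext \<zeta>"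
    by (auto simp: ext_iff coord_simps Ast_scale) (metis distrib_left mult.left_commute mult_zero_right)
qed

text \<open>Membership in the adjoint means that the boundary form vanishes against the domain of
  \<open>ext \<zeta>\<close>. Modulo the domain of \<open>A\<close> this is one equation, tested on
  \<open>e\<close>; its conjugate is the line with parameter \<open>1 / cnj \<zeta>\<close>.\<close>

lemma adjoint_ext:
  assumes z: "\<zeta> \<noteq> 0"
  shows "op_adjoint (ext \<zeta>) = ext (1 / cnj \<zeta>)"
proof (rule set_eqI, safe)
  fix g h assume gh: "(g, h) \<in> op_adjoint (ext \<zeta>)"
  then have "(g, h) \<in> op_adjoint A"
    using op_adjoint_antimono[OF subset_ext] by blast
  then have g: "g \<in> hplus A" "Ast g = h"
    using hplusI Ast_eq by auto
  define e where "e = g\<^sub>p - \<zeta> *\<^sub>C g\<^sub>m"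
  have e: "e \<in> hplus A" "cp e = 1" "cm e = - \<zeta>"
    by (simp_all add: e_def coord_simps)
  then have "(e, Ast e) \<in> ext \<zeta>"
    by (simp add: ext_iff)
  from op_adjointD[OF gh this] have "cnj (cp g) + \<zeta> * cnj (cm g) = 0"
    using boundary_form[OF e(1) g(1)] by (simp add: e g)
  then have "cnj (cnj (cp g) + \<zeta> * cnj (cm g)) = 0"
    by (simp only: complex_cnj_zero)
  then show "(g, h) \<in> ext (1 / cnj \<zeta>)"
    using z g by (simp add: ext_iff field_simps add.commute)
next
  fix g h assume "(g, h) \<in> ext (1 / cnj \<zeta>)"
  then have g: "g \<in> hplus A" "h = Ast g" and "cm g + cp g / cnj \<zeta> = 0"
    by (simp_all add: ext_iff)
  then have "cnj (cm g * cnj \<zeta> + cp g) = 0"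
    using z by (simp add: field_simps)
  then have c: "cnj (cp g) = - \<zeta> * cnj (cm g)"
    by (simp add: eq_neg_iff_add_eq_0 mult.commute add.commute)
  show "(g, h) \<in> op_adjoint (ext \<zeta>)"
    unfolding op_adjoint_iff
  proof safe
    fix f f' assume "(f, f') \<in> ext \<zeta>"
    then have f: "f \<in> hplus A" "f' = Ast f" "cm f = - \<zeta> * cp f"
      by (simp_all add: ext_iff eq_neg_iff_add_eq_0)
    show "cinner f' g = cinner f h"
      using boundary_form[OF f(1) g(1)] by (simp add: f g c)
  qed
qed

lemma self_adjoint_ext:
  assumes "cmod \<zeta> = 1"
  shows "self_adjoint_operator (ext \<zeta>)"
proof -
  have "\<zeta> * cnj \<zeta> = 1"
    using assms complex_norm_square[of \<zeta>] by simp
  moreover from assms have "\<zeta> \<noteq> 0"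
    by auto
  ultimately have "1 / cnj \<zeta> = \<zeta>" "\<zeta> \<noteq> 0"
    by (simp_all add: divide_eq_eq)
  then have "op_adjoint (ext \<zeta>) = ext \<zeta>"
    using adjoint_ext by simp
  moreover have "densely_defined (ext \<zeta>)"
    using dense closure_mono[OF Domain_mono[OF subset_ext[of \<zeta>]]]
    by (auto simp: densely_defined_def)
  ultimately show ?thesis
    by (simp add: self_adjoint_operator_def linear_ext)
qed

section \<open>The Livsic function\<close>

text \<open>For unimodular \<open>\<zeta>\<close> and nonreal \<open>z\<close> this is
  \<open>ext \<zeta> - \<i>\<close> applied to the resolvent of \<open>ext \<zeta>\<close> at
  \<open>z\<close>, the standard map from the deficiency space at \<open>\<i>\<close> to that at
  \<open>z\<close>.\<close>

definition defect :: "complex \<Rightarrow> complex \<Rightarrow> 'a" where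
  "defect \<zeta> z = g\<^sub>p + (z - \<i>) *\<^sub>C op_resolvent (ext \<zeta>) z g\<^sub>p"

text \<open>The resolvent term lies in the domain of \<open>ext \<zeta>\<close>, where
  \<open>cm + \<zeta> * cp\<close> vanishes, so only \<open>g\<^sub>p\<close> contributes to this
  combination.\<close>

lemma
  assumes \<zeta>: "cmod \<zeta> = 1" and z: "0 < Im z"
  shows defect_mem: "defect \<zeta> z \<in> deficiency_space A z"
    and defect_coords: "cm (defect \<zeta> z) + \<zeta> * cp (defect \<zeta> z) = \<zeta>"
    and defect_nonzero: "defect \<zeta> z \<noteq> 0"
proof -
  define r where "r = op_resolvent (ext \<zeta>) z g\<^sub>p"
  have "(r, g\<^sub>p + z *\<^sub>C r) \<in> ext \<zeta>"
    using op_resolvent_mem[OF self_adjoint_ext[OF \<zeta>]] z by (simp add: r_def)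
  then have r: "r \<in> hplus A" "Ast r = g\<^sub>p + z *\<^sub>C r" "cm r + \<zeta> * cp r = 0"
    by (auto simp: ext_iff)
  show "defect \<zeta> z \<in> deficiency_space A z"
    unfolding defect_def r_def[symmetric]
    by (simp add: deficiency_space_iff coord_simps r Ast_add Ast_scale Ast_gp)
       (simp add: scaleC_add_right scaleC_scaleC algebra_simps)
  have "cm (defect \<zeta> z) + \<zeta> * cp (defect \<zeta> z) = \<zeta> + (z - \<i>) * (cm r + \<zeta> * cp r)"
    unfolding defect_def r_def[symmetric] by (simp add: coord_simps r(1) algebra_simps)
  then show *: "cm (defect \<zeta> z) + \<zeta> * cp (defect \<zeta> z) = \<zeta>"
    by (simp add: r)
  show "defect \<zeta> z \<noteq> 0"
  proof
    assume "defect \<zeta> z = 0"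
    moreover have "cm 0 = 0" "cp 0 = 0"
      using cm_diff[OF gp_hplus gp_hplus] cp_diff[OF gp_hplus gp_hplus] by simp_all
    ultimately show False
      using * \<zeta> by auto
  qed
qed

abbreviation "liv \<equiv> livsic_function A g\<^sub>p g\<^sub>m"

text \<open>Makes the arbitrary choice in \<open>livsic_function\<close> harmless:
  \<open>deficiency_coords\<close> reduces the quotient to coordinates, and proportionality passes
  from the chosen vector to \<open>g\<close>.\<close>

lemma livsic_eq:
  assumes z: "0 < Im z" and g: "g \<in> deficiency_space A z" "g \<noteq> 0"
  shows "liv z = - cm g / cp g" and "cp g \<noteq> 0"
proof -
  show cp: "cp g \<noteq> 0"
    using deficiency_coord_less[OF g z] by auto
  define u where "u = (SOME g. g \<in> deficiency_space A z \<and> g \<noteq> 0)"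
  have "u \<in> deficiency_space A z \<and> u \<noteq> 0"
    unfolding u_def by (rule someI) (use g in blast)
  then have u: "u \<in> deficiency_space A z" "u \<noteq> 0" by auto
  then have cpu: "cp u \<noteq> 0"
    using deficiency_coord_less[OF u z] by auto
  have "liv z = ((z - \<i>) * cinner u g\<^sub>m) / ((z + \<i>) * cinner u g\<^sub>p)"
    by (simp add: livsic_function_def u_def[symmetric])
  also have "\<dots> = - cm u / cp u"
    unfolding deficiency_coords(2,3)[OF u(1)] by simp
  also have "\<dots> = - cm g / cp g"
    using deficiency_space_proportional[OF g(1) u(1) z] cp cpu by (simp add: field_simps)
  finally show "liv z = - cm g / cp g" .
qed

lemma livsic_minus:
  assumes z: "0 < Im z" and \<zeta>: "cmod \<zeta> = 1"
  shows "liv z - \<zeta> = - \<zeta> * (2 * \<i>) / ((z + \<i>) * cinner (defect \<zeta> z) g\<^sub>p)"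
    and "cinner (defect \<zeta> z) g\<^sub>p \<noteq> 0" and "z + \<i> \<noteq> 0"
proof -
  note d = defect_mem[OF \<zeta> z] defect_nonzero[OF \<zeta> z]
  note l = livsic_eq[OF z d]
  have "liv z - \<zeta> = - (cm (defect \<zeta> z) + \<zeta> * cp (defect \<zeta> z)) / cp (defect \<zeta> z)"
    using l by (simp add: field_simps)
  also have "\<dots> = - \<zeta> * (2 * \<i>) / (2 * \<i> * cp (defect \<zeta> z))"
    unfolding defect_coords[OF \<zeta> z] by simp
  finally show "liv z - \<zeta> = - \<zeta> * (2 * \<i>) / ((z + \<i>) * cinner (defect \<zeta> z) g\<^sub>p)"
    by (simp only: deficiency_coords(2)[OF d(1)])
  show "cinner (defect \<zeta> z) g\<^sub>p \<noteq> 0"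
    using deficiency_coords(2)[OF d(1)] l by auto
  show "z + \<i> \<noteq> 0"
    using z by (auto simp: complex_eq_iff)
qed

text \<open>The chosen deficiency vectors need not depend nicely on \<open>z\<close>, but
  \<open>livsic_minus\<close> with \<open>\<zeta> = 1\<close> expresses the function through a
  resolvent.\<close>

lemma livsic_holomorphic: "liv holomorphic_on upper_half_plane"
proof -
  have "(\<lambda>z. 1 + - 1 * (2 * \<i>) / ((z + \<i>) * cinner (defect 1 z) g\<^sub>p)) holomorphic_on upper_half_plane"
  proof (intro holomorphic_intros)
    show "(\<lambda>z. cinner (defect 1 z) g\<^sub>p) holomorphic_on upper_half_plane"
      unfolding defect_def cinner_add_left cinner_scaleC_left
      by (intro holomorphic_intros holomorphic_cinner_op_resolvent self_adjoint_ext) simp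
    fix z assume "z \<in> upper_half_plane"
    then show "(z + \<i>) * cinner (defect 1 z) g\<^sub>p \<noteq> 0"
      using livsic_minus(2,3)[of z 1] by simp
  qed
  then show ?thesis
  proof (rule holomorphic_transform)
    fix z assume "z \<in> upper_half_plane"
    then show "1 + - 1 * (2 * \<i>) / ((z + \<i>) * cinner (defect 1 z) g\<^sub>p) = liv z"
      using livsic_minus(1)[of z 1] by (simp add: diff_eq_eq)
  qed
qed

lemma livsic_norm_less_1:
  assumes z: "0 < Im z"
  shows "cmod (liv z) < 1"
proof -
  note d = defect_mem[of 1, OF _ z] defect_nonzero[of 1, OF _ z]
  show ?thesis
    using livsic_eq[OF z d] deficiency_coord_less[OF d z] by (simp add: norm_divide divide_less_eq)
qed

end

section \<open>Limits at infinity in sectors\<close>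

lemma sector_Im_ge:
  assumes "z \<noteq> 0" "0 < \<epsilon>" "\<epsilon> \<le> Arg z" "Arg z \<le> pi - \<epsilon>"
  shows "cmod z * sin \<epsilon> \<le> Im z" and "0 < sin \<epsilon>"
proof -
  have "Im z = Im (complex_of_real (cmod z) * exp (\<i> * complex_of_real (Arg z)))"
    using Arg_eq[OF assms(1)] by simp
  also have "\<dots> = cmod z * sin (Arg z)"
    by (simp add: exp_Euler cos_of_real sin_of_real)
  finally have Im: "Im z = cmod z * sin (Arg z)" .
  have "sin \<epsilon> \<le> sin (Arg z)"
  proof (cases "Arg z \<le> pi / 2")
    case True
    then show ?thesis
      using assms by (intro sin_monotone_2pi_le) auto
  next
    case False
    then have "sin \<epsilon> \<le> sin (pi - Arg z)"
      using assms by (intro sin_monotone_2pi_le) auto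
    then show ?thesis by simp
  qed
  then show "cmod z * sin \<epsilon> \<le> Im z"
    unfolding Im by (intro mult_left_mono) auto
  show "0 < sin \<epsilon>"
    using assms by (intro sin_gt_zero) auto
qed

text \<open>For \<open>y\<close> in the domain, \<open>y + (z - i) R\<^sub>z y = R\<^sub>z (T y - i y)\<close>; the general case follows by
  density, as these maps are uniformly bounded in the sector.\<close>

lemma resolvent_sector_limit:
  fixes T :: "('a::chilbert_space \<times> 'a) set"
  assumes sa: "self_adjoint_operator T" and e: "0 < \<epsilon>"
  shows "((\<lambda>z. y + (z - \<i>) *\<^sub>C op_resolvent T z y) \<longlongrightarrow> 0)
    (inf at_infinity (principal {z. z \<noteq> 0 \<and> \<epsilon> \<le> Arg z \<and> Arg z \<le> pi - \<epsilon>}))"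
    (is "(?P y \<longlongrightarrow> 0) ?F")
proof -
  have sector: "eventually (\<lambda>z. z \<noteq> 0 \<and> \<epsilon> \<le> Arg z \<and> Arg z \<le> pi - \<epsilon> \<and> b \<le> cmod z) ?F" for b
    by (auto simp: eventually_inf_principal eventually_at_infinity intro!: exI[of _ b])
  \<comment> \<open>For \<open>cmod z \<ge> 1\<close> one has
    \<open>cmod (z - \<i>) \<le> 2 * cmod z\<close>, while the resolvent has norm at most
    \<open>1 / (cmod z * sin \<epsilon>)\<close>.\<close>
  define C where "C = 1 + 2 / sin \<epsilon>"
  have bound: "norm (?P x z) \<le> C * norm x"
    if z: "z \<noteq> 0" "\<epsilon> \<le> Arg z" "Arg z \<le> pi - \<epsilon>" "1 \<le> cmod z" for x z
  proof -
    note s = sector_Im_ge[OF z(1) e z(2,3)]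
    have Im: "0 < Im z"
      using s z(1) by (smt (verit) mult_pos_pos zero_less_norm_iff)
    have "cmod (z - \<i>) \<le> 2 * cmod z"
      using norm_triangle_ineq4[of z \<i>] z(4) by simp
    then have "sin \<epsilon> * cmod (z - \<i>) \<le> 2 * (cmod z * sin \<epsilon>)"
      using s(2) by simp
    also have "\<dots> \<le> 2 * Im z" using s(1) by simp
    finally have "sin \<epsilon> * cmod (z - \<i>) * norm (op_resolvent T z x) \<le> 2 * Im z * norm (op_resolvent T z x)"
      by (rule mult_right_mono) simp
    also have "\<dots> \<le> 2 * norm x"
      using norm_op_resolvent_le[OF sa, of z x] Im by simp
    finally have "cmod (z - \<i>) * norm (op_resolvent T z x) \<le> 2 / sin \<epsilon> * norm x"
      using s(2) by (simp add: field_simps)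
    moreover have "C * norm x = norm x + 2 / sin \<epsilon> * norm x"
      by (simp add: C_def distrib_right)
    ultimately show ?thesis
      using norm_triangle_ineq[of x "(z - \<i>) *\<^sub>C op_resolvent T z x"] unfolding norm_scaleC
      by linarith
  qed
  have dom: "norm (?P f z) \<le> norm (f' - \<i> *\<^sub>C f) / (sin \<epsilon> * cmod z)"
    if f: "(f, f') \<in> T" and z: "z \<noteq> 0" "\<epsilon> \<le> Arg z" "Arg z \<le> pi - \<epsilon>" for f f' z
  proof -
    note s = sector_Im_ge[OF z(1) e z(2,3)]
    have Im: "0 < Im z"
      using s z(1) by (smt (verit) mult_pos_pos zero_less_norm_iff)
    have lin: "linear_operator T" using sa by (simp add: self_adjoint_operator_def)
    define r where "r = op_resolvent T z f"
    have r: "(r, f + z *\<^sub>C r) \<in> T"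
      using op_resolvent_mem[OF sa] Im by (simp add: r_def)
    have "(f + (z - \<i>) *\<^sub>C r, f' + (z - \<i>) *\<^sub>C (f + z *\<^sub>C r)) \<in> T"
      by (intro linear_operatorD(3,4)[OF lin] f r)
    moreover have "f' + (z - \<i>) *\<^sub>C (f + z *\<^sub>C r) = (f' - \<i> *\<^sub>C f) + z *\<^sub>C (f + (z - \<i>) *\<^sub>C r)"
      by (simp add: scaleC_add_right scaleC_scaleC complex_vector.scale_left_diff_distrib algebra_simps)
    ultimately have "(?P f z, (f' - \<i> *\<^sub>C f) + z *\<^sub>C ?P f z) \<in> T"
      unfolding r_def by (simp only:)
    then have "op_resolvent T z (f' - \<i> *\<^sub>C f) = ?P f z"
      by (rule op_resolvent_unique[OF sa, rotated]) (use Im in simp)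
    then have "Im z * norm (?P f z) \<le> norm (f' - \<i> *\<^sub>C f)"
      using norm_op_resolvent_le[OF sa, of z "f' - \<i> *\<^sub>C f"] Im by simp
    moreover have "cmod z * sin \<epsilon> * norm (?P f z) \<le> Im z * norm (?P f z)"
      using s(1) by (intro mult_right_mono) auto
    ultimately show ?thesis
      using s(2) z(1) by (simp add: field_simps)
  qed
  show ?thesis
  proof (rule tendstoI)
    fix d :: real assume d: "0 < d"
    show "eventually (\<lambda>z. dist (?P y z) 0 < d) ?F"
    proof (cases "0 < sin \<epsilon>")
      \<comment> \<open>A nonempty sector has \<open>sin \<epsilon> > 0\<close>, so here the sector
        is empty and the claim vacuous.\<close>
      case False
      from sector[of 0] show ?thesis
        by eventually_elim (use sector_Im_ge(2)[OF _ e] False in blast)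
    next
      case True
      then have C: "0 < C"
        by (simp add: C_def add_pos_pos)
      have "y \<in> closure (Domain T)"
        using sa by (simp add: self_adjoint_operator_def densely_defined_def)
      then obtain f where "f \<in> Domain T" and fy: "dist f y < d / (2 * C)"
        unfolding closure_approachable using d C by (meson divide_pos_pos mult_pos_pos zero_less_numeral)
      then obtain f' where f: "(f, f') \<in> T" by auto
      define N where "N = norm (f' - \<i> *\<^sub>C f)"
      \<comment> \<open>The \<open>1\<close> is for \<open>bound\<close>; the other threshold makes
        the estimate \<open>dom\<close> smaller than \<open>d / 2\<close>, strictly so because of
        \<open>N + 1\<close>.\<close>
      from sector[of "max 1 (2 * (N + 1) / (sin \<epsilon> * d))"] show ?thesis
      proof eventually_elim
        case (elim z)
        then have z: "z \<noteq> 0" "\<epsilon> \<le> Arg z" "Arg z \<le> pi - \<epsilon>" "1 \<le> cmod z"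
          and zb: "2 * (N + 1) / (sin \<epsilon> * d) \<le> cmod z" by auto
        have Im: "Im z \<noteq> 0"
          using sector_Im_ge[OF z(1) e z(2,3)] z(1) by (smt (verit) mult_pos_pos zero_less_norm_iff)
        have "2 * N < d * (sin \<epsilon> * cmod z)"
          using zb True d by (simp add: field_simps)
        then have "N / (sin \<epsilon> * cmod z) < d / 2"
          using True z(1) by (simp add: field_simps)
        then have "norm (?P f z) < d / 2"
          by (rule le_less_trans[OF dom[OF f z(1-3), folded N_def]])
        moreover have "norm (?P (y - f) z) < d / 2"
        proof -
          have "norm (?P (y - f) z) \<le> C * norm (y - f)"
            by (rule bound[OF z])
          also have "\<dots> < d / 2"
            using fy C by (simp add: dist_norm norm_minus_commute field_simps)
          finally show ?thesis .
        qed
        moreover have "?P y z = ?P f z + ?P (y - f) z"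
          by (simp add: op_resolvent_diff[OF sa Im] complex_vector.scale_right_diff_distrib)
        ultimately have "norm (?P y z) < d"
          using norm_triangle_lt[of "?P f z" "?P (y - f) z" d] by (simp only:)
        then show ?case
          by (simp only: dist_norm diff_0_right)
      qed
    qed
  qed
qed

context symmetric_1_1
begin

text \<open>By \<open>livsic_minus\<close> and \<open>cmod (z + \<i>) \<le> 2 * cmod z\<close>, the
  modulus is at least the reciprocal of \<open>cmod (cinner (defect \<zeta> z) g\<^sub>p)\<close>,
  and \<open>defect \<zeta> z\<close> tends to \<open>0\<close>.\<close>

lemma livsic_sector_limit:
  assumes e: "0 < \<epsilon>" and \<zeta>: "cmod \<zeta> = 1"
  shows "filterlim (\<lambda>z. z * (liv z - \<zeta>)) at_infinity
    (inf at_infinity (principal {z. z \<noteq> 0 \<and> \<epsilon> \<le> Arg z \<and> Arg z \<le> pi - \<epsilon>}))"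
    (is "filterlim _ _ ?F")
proof -
  have sector: "eventually (\<lambda>z. z \<noteq> 0 \<and> \<epsilon> \<le> Arg z \<and> Arg z \<le> pi - \<epsilon> \<and> 1 \<le> cmod z) ?F"
    by (auto simp: eventually_inf_principal eventually_at_infinity intro!: exI[of _ 1])
  have lim: "(defect \<zeta> \<longlongrightarrow> 0) ?F"
    unfolding defect_def by (rule resolvent_sector_limit[OF self_adjoint_ext[OF \<zeta>] e])
  show ?thesis
    unfolding filterlim_at_infinity[OF order_refl]
  proof (intro allI impI)
    fix r :: real assume r: "0 < r"
    then have "eventually (\<lambda>z. dist (defect \<zeta> z) 0 < 1 / r) ?F"
      using lim by (intro tendstoD) auto
    with sector show "eventually (\<lambda>z. r \<le> cmod (z * (liv z - \<zeta>))) ?F"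
    proof eventually_elim
      case (elim z)
      have Im: "0 < Im z"
        using sector_Im_ge[of z \<epsilon>] elim e by (smt (verit) mult_pos_pos zero_less_norm_iff)
      let ?c = "cmod (cinner (defect \<zeta> z) g\<^sub>p)"
      note l = livsic_minus[OF Im \<zeta>]
      have "?c \<le> norm (defect \<zeta> z)"
        using Cauchy_Schwarz_cinner[of "defect \<zeta> z" g\<^sub>p] gp(2) by simp
      also have "\<dots> < 1 / r" using elim by simp
      finally have "r * ?c \<le> 1"
        using r by (simp add: field_simps)
      moreover have "cmod (z + \<i>) \<le> 2 * cmod z"
        using norm_triangle_ineq[of z \<i>] elim by simp
      ultimately have "(r * ?c) * cmod (z + \<i>) \<le> 1 * (2 * cmod z)"
        using r by (intro mult_mono) auto
      then have "r \<le> 2 * cmod z / (cmod (z + \<i>) * ?c)"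
        using l(2,3) by (subst pos_le_divide_eq) (simp_all add: mult_ac)
      also have "\<dots> = cmod (z * (liv z - \<zeta>))"
        unfolding l(1) by (simp add: norm_mult norm_divide \<zeta>)
      finally show ?case .
    qed
  qed
qed

theorem livsic_in_L_class: "liv \<in> L_class"
  unfolding L_class_def
proof (intro CollectI conjI ballI allI impI)
  show "liv holomorphic_on upper_half_plane"
    by (rule livsic_holomorphic)
  show "liv ` upper_half_plane \<subseteq> ball 0 1"
    using livsic_norm_less_1 by auto
  show "liv \<i> = 0"
    by (simp add: livsic_function_def)
  fix \<alpha> \<epsilon> :: real assume "0 < \<epsilon>"
  moreover have "cmod (exp (2 * \<i> * complex_of_real \<alpha>)) = 1"
    by simp
  ultimately show "filterlim (\<lambda>z. z * (liv z - exp (2 * \<i> * complex_of_real \<alpha>))) at_infinity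
      (inf at_infinity (principal {z. z \<noteq> 0 \<and> \<epsilon> \<le> Arg z \<and> Arg z \<le> pi - \<epsilon>}))"
    by (rule livsic_sector_limit)
qed

end

section \<open>L-systems\<close>

locale L_system_H = symmetric_1_1 A g\<^sub>p g\<^sub>m
  for A :: "('a::chilbert_space \<times> 'a) set" and g\<^sub>p g\<^sub>m :: 'a +
  fixes T A_hat :: "('a \<times> 'a) set" and \<AA> :: "'a \<Rightarrow> 'a \<Rightarrow> complex"
    and K :: "complex \<Rightarrow> 'a \<Rightarrow> complex" and \<kappa> :: real
  assumes L_sys: "L_system A \<AA> K"
    and T_eq: "T = main_operator A \<AA>"
    and A_hat_eq: "A_hat = quasi_kernel A (re_part A \<AA>)"
    and \<kappa>: "0 \<le> \<kappa>" "\<kappa> < 1"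
    and H: "hypothesis_H A T A_hat (complex_of_real \<kappa>) g\<^sub>p g\<^sub>m"
begin

lemma star_ext: obtains T' where "star_extension A T' \<AA>"
  using L_sys unfolding L_system_def by blast

lemma bounded: "bounded_plus_minus A \<AA>"
  using star_ext unfolding star_extension_def by blast

lemma hminus_op: "f \<in> hplus A \<Longrightarrow> \<AA> f \<in> hminus A"
  using bounded unfolding bounded_plus_minus_def by blast

lemma linear_T: "linear_operator T" and A_subset_T: "A \<subseteq> T" and dissipative_T: "dissipative_operator T"
  using H unfolding hypothesis_H_def maximal_dissipative_extension_def by auto

text \<open>The functional \<open>\<AA> f\<close> minus the embedded vector \<open>Ast f\<close>,
  evaluated at \<open>u\<close>; linear in \<open>u\<close> and conjugate linear in
  \<open>f\<close>.\<close>

definition q :: "'a \<Rightarrow> 'a \<Rightarrow> complex" where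
  "q f u = \<AA> f u - cinner u (Ast f)"

lemma
  assumes "f \<in> hplus A" "v \<in> hplus A"
  shows q_add_left: "q (f + v) u = q f u + q v u"
    and q_add_right: "u \<in> hplus A \<Longrightarrow> q u (f + v) = q u f + q u v"
    and q_scale_left: "q (c *\<^sub>C f) u = cnj c * q f u"
    and q_scale_right: "u \<in> hplus A \<Longrightarrow> q u (c *\<^sub>C f) = c * q u f"
proof -
  have "\<AA> (f + v) = \<AA> f + \<AA> v" "\<AA> (c *\<^sub>C f) = dual_scale c (\<AA> f)"
    using bounded assms unfolding bounded_plus_minus_def by blast+
  then show "q (f + v) u = q f u + q v u" "q (c *\<^sub>C f) u = cnj c * q f u"
    by (simp_all add: q_def Ast_add Ast_scale assms cinner_simps dual_scale_def algebra_simps)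
next
  assume "u \<in> hplus A"
  then have "\<AA> u \<in> hminus A" by (rule hminus_op)
  then have "\<AA> u (f + v) = \<AA> u f + \<AA> u v" "\<AA> u (c *\<^sub>C f) = c * \<AA> u f"
    using assms unfolding hminus_def by auto
  then show "q u (f + v) = q u f + q u v" "q u (c *\<^sub>C f) = c * q u f"
    by (simp_all add: q_def cinner_simps algebra_simps)
qed

lemma q_diff_left: "f \<in> hplus A \<Longrightarrow> v \<in> hplus A \<Longrightarrow> q (f - v) u = q f u - q v u"
  using q_add_left[of "f - v" v u] hplus_diff by simp

section \<open>The main operator and its adjoint in boundary coordinates\<close>

lemma T_subset_adjoint: "T \<subseteq> op_adjoint A"
proof (rule subrelI)
  fix f h assume "(f, h) \<in> T"
  then have f: "f \<in> hplus A" "\<AA> f = h_embed A h"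
    by (auto simp: T_eq main_operator_def)
  obtain T' where st: "star_extension A T' \<AA>" by (rule star_ext)
  show "(f, h) \<in> op_adjoint A"
    unfolding op_adjoint_iff
  proof safe
    fix u u' assume u: "(u, u') \<in> A"
    then have up: "u \<in> hplus A" by (rule Domain_hplus)
    have "bi_adjoint A \<AA> u = h_embed A u'"
      using st u unfolding star_extension_def extends_op_def by blast
    then have "bi_adjoint A \<AA> u f = h_embed A u' f" by simp
    then have "cnj (cinner u h) = cinner f u'"
      using f up by (simp add: bi_adjoint_def h_embed_def)
    then show "cinner u' f = cinner u h"
      by (metis cinner_commute complex_cnj_cnj)
  qed
qed

lemma T_iff: "(f, h) \<in> T \<longleftrightarrow> f \<in> hplus A \<and> h = Ast f \<and> (\<forall>u \<in> hplus A. q f u = 0)"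
proof
  assume fh: "(f, h) \<in> T"
  then have "f \<in> hplus A" "\<AA> f = h_embed A h" "Ast f = h"
    using T_subset_adjoint Ast_eq by (auto simp: T_eq main_operator_def)
  then show "f \<in> hplus A \<and> h = Ast f \<and> (\<forall>u \<in> hplus A. q f u = 0)"
    by (simp add: q_def h_embed_def)
next
  assume *: "f \<in> hplus A \<and> h = Ast f \<and> (\<forall>u \<in> hplus A. q f u = 0)"
  then have "\<AA> f u = h_embed A (Ast f) u" for u
    using hminus_op[of f] unfolding h_embed_def hminus_def q_def by auto
  then have "\<AA> f = h_embed A (Ast f)" ..
  with * show "(f, h) \<in> T"
    by (simp add: T_eq main_operator_def)
qed

text \<open>If \<open>cm f + \<kappa> cp f\<close> were nonzero for some \<open>f\<close> in the domain of \<open>T\<close>, this domain would contain a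
  vector with coordinates \<open>(0, d)\<close>, \<open>d \<noteq> 0\<close>, on which \<open>T\<close> is not dissipative.\<close>

lemma T_coords:
  assumes f: "(f, f') \<in> T"
  shows "cm f + \<kappa> * cp f = 0"
proof -
  obtain h where h: "(g\<^sub>p - complex_of_real \<kappa> *\<^sub>C g\<^sub>m, h) \<in> T"
    using H by (auto simp: hypothesis_H_def)
  define w where "w = f - cp f *\<^sub>C (g\<^sub>p - complex_of_real \<kappa> *\<^sub>C g\<^sub>m)"
  have fp: "f \<in> hplus A" using f by (simp add: T_iff)
  have "(w, f' - cp f *\<^sub>C h) \<in> T"
    unfolding w_def by (intro linear_operator_diff linear_operatorD(4) linear_T f h)
  then have wT: "(w, Ast w) \<in> T" and w: "w \<in> hplus A"
    by (auto simp: T_iff)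
  have cw: "cp w = 0" "cm w = cm f + \<kappa> * cp f"
    by (simp_all add: w_def coord_simps fp mult.commute)
  have "0 \<le> Im (cinner (Ast w) w)"
    using wT dissipative_T by (auto simp: dissipative_operator_def)
  moreover have "cinner w (Ast w) = cnj (cinner (Ast w) w)"
    by (rule cinner_commute)
  then have "Im (cinner (Ast w) w - cinner w (Ast w)) = 2 * Im (cinner (Ast w) w)"
    by simp
  then have "2 * Im (cinner (Ast w) w) = Im (- (2 * \<i> * complex_of_real ((cmod (cm w))\<^sup>2)))"
    using boundary_form[OF w w] unfolding complex_norm_square by (simp add: cw(1))
  then have "Im (cinner (Ast w) w) = - (cmod (cm w))\<^sup>2"
    by (simp del: of_real_power)
  ultimately have "cm w = 0"
    by simp
  then show ?thesis
    using cw by simp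
qed

text \<open>By von Neumann's formula such an \<open>f\<close> is an element of the domain of
  \<open>A\<close> plus a multiple of \<open>g\<^sub>p - \<kappa> g\<^sub>m\<close>, which
  hypothesis (H) puts in the domain of \<open>T\<close>.\<close>

lemma T_memI:
  assumes f: "f \<in> hplus A" and c: "cm f + \<kappa> * cp f = 0"
  shows "(f, Ast f) \<in> T"
proof -
  obtain e where e: "(g\<^sub>p - complex_of_real \<kappa> *\<^sub>C g\<^sub>m, e) \<in> T"
    using H by (auto simp: hypothesis_H_def)
  obtain h h' where h: "(h, h') \<in> A" and eq: "f = h + cp f *\<^sub>C g\<^sub>p + cm f *\<^sub>C g\<^sub>m"
    using von_Neumann_decomposition[OF f] by blast
  have "cm f = - (cp f * \<kappa>)"
    using c by (simp add: eq_neg_iff_add_eq_0 mult.commute)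
  then have "h + cp f *\<^sub>C (g\<^sub>p - complex_of_real \<kappa> *\<^sub>C g\<^sub>m) = f"
    by (subst (2) eq) (simp add: complex_vector.scale_right_diff_distrib scaleC_scaleC
        complex_vector.scale_minus_left)
  moreover have "(h + cp f *\<^sub>C (g\<^sub>p - complex_of_real \<kappa> *\<^sub>C g\<^sub>m), h' + cp f *\<^sub>C e) \<in> T"
    using h A_subset_T by (intro linear_operatorD(3,4)[OF linear_T] e) blast
  ultimately show ?thesis
    by (auto simp: T_iff)
qed

lemma T_adjoint_memI:
  assumes v: "v \<in> hplus A" and c: "cp v + \<kappa> * cm v = 0"
  shows "(v, Ast v) \<in> op_adjoint T"
  unfolding op_adjoint_iff
proof safe
  fix f f' assume fT: "(f, f') \<in> T"
  then have f: "f \<in> hplus A" "f' = Ast f" by (auto simp: T_iff)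
  have "cm f = - \<kappa> * cp f" and "cp v = - \<kappa> * cm v"
    using T_coords[OF fT] c by (simp_all add: eq_neg_iff_add_eq_0)
  then show "cinner f' v = cinner f (Ast v)"
    using boundary_form[OF f(1) v] f(2) by simp
qed

section \<open>Determination of \<open>\<AA>\<close> and \<open>K\<close>\<close>

text \<open>On this line the adjoint of \<open>\<AA>\<close> acts as \<open>Ast\<close>, so
  \<open>q u v\<close> is a boundary form. The extension property is given for the adjoint of a
  witness \<open>T'\<close>; as \<open>T' \<subseteq> T\<close>, it covers the adjoint of
  \<open>T\<close>.\<close>

lemma q_right:
  assumes v: "v \<in> hplus A" and c: "cp v + \<kappa> * cm v = 0" and u: "u \<in> hplus A"
  shows "q u v = 2 * \<i> * (cp v * cnj (cp u) - cm v * cnj (cm u))"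
proof -
  obtain T' where st: "star_extension A T' \<AA>" by (rule star_ext)
  then have "T' \<subseteq> T"
    unfolding star_extension_def extends_op_def T_eq main_operator_def by auto
  then have "(v, Ast v) \<in> op_adjoint T'"
    using T_adjoint_memI[OF v c] op_adjoint_antimono by blast
  then have "bi_adjoint A \<AA> v = h_embed A (Ast v)"
    using st unfolding star_extension_def extends_op_def by blast
  then have "bi_adjoint A \<AA> v u = h_embed A (Ast v) u" by simp
  then have "cnj (\<AA> u v) = cinner u (Ast v)"
    using u by (simp add: bi_adjoint_def h_embed_def)
  then have "\<AA> u v = cinner (Ast v) u"
    by (metis cinner_commute complex_cnj_cnj)
  then show ?thesis
    using boundary_form[OF v u] by (simp add: q_def)
qed

text \<open>Subtracting a multiple of \<open>g\<^sub>m\<close> moves \<open>f\<close> into the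
  domain of \<open>T\<close>, where \<open>q\<close> vanishes; hence \<open>q\<close> has rank
  one.\<close>

lemma q_eq_gm:
  assumes f: "f \<in> hplus A" and u: "u \<in> hplus A"
  shows "q f u = cnj (cm f + \<kappa> * cp f) * q g\<^sub>m u"
proof -
  define d where "d = cm f + \<kappa> * cp f"
  define w where "w = f - d *\<^sub>C g\<^sub>m"
  have "w \<in> hplus A" "cm w + \<kappa> * cp w = 0"
    by (simp_all add: w_def coord_simps f d_def)
  from T_memI[OF this] have "q w u = 0"
    using u by (simp add: T_iff)
  then show ?thesis
    by (simp add: w_def q_diff_left f hplus_scale q_scale_left[of g\<^sub>m g\<^sub>m] d_def)
qed

text \<open>Hypothesis (H) puts \<open>e\<close> in the domain of the quasi-kernel, which is a
  restriction of the adjoint of \<open>A\<close>; so the real part of \<open>\<AA>\<close> sends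
  \<open>e\<close> to \<open>Ast e\<close>, tested here on \<open>u\<close>.\<close>

lemma A_hat_relation:
  assumes u: "u \<in> hplus A"
  defines "e \<equiv> g\<^sub>p - g\<^sub>m"
  shows "q e u + 2 * \<i> * (cp u + cm u) + cnj (q u e) = 0"
proof -
  have e: "e \<in> hplus A" "cp e = 1" "cm e = - 1"
    by (simp_all add: e_def coord_simps)
  obtain h where h: "(e, h) \<in> A_hat"
    using H by (auto simp: hypothesis_H_def e_def)
  have "op_adjoint A_hat = A_hat" "A \<subseteq> A_hat"
    using H by (simp_all add: hypothesis_H_def self_adjoint_operator_def)
  then have "Ast e = h"
    using h op_adjoint_antimono[of A A_hat] Ast_eq by blast
  then have "re_part A \<AA> e = h_embed A (Ast e)"
    using h by (simp add: A_hat_eq quasi_kernel_def)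
  then have "re_part A \<AA> e u = h_embed A (Ast e) u" by simp
  then have "\<AA> e u + cnj (\<AA> u e) = 2 * cinner u (Ast e)"
    using u by (simp add: re_part_def dual_scale_def bi_adjoint_def h_embed_def field_simps)
  moreover have "cnj (cinner e (Ast u)) = cinner (Ast u) e"
    by (metis cinner_commute)
  ultimately have "q e u + (cinner (Ast u) e - cinner u (Ast e)) + cnj (q u e) = 0"
    by (simp add: q_def algebra_simps)
  then show ?thesis
    using boundary_form[OF u e(1)] by (simp add: e)
qed

text \<open>The functional vanishes on the domain of \<open>A\<close>, so it is given by two numbers
  \<open>P\<close> and \<open>M\<close>. The adjoint of \<open>T\<close> and the quasi-kernel yield
  one linear equation each.\<close>

lemma q_gm:
  assumes u: "u \<in> hplus A"
  shows "q g\<^sub>m u = 2 * \<i> / (1 + \<kappa>) * (cp u - cm u)"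
proof -
  let ?k = "complex_of_real \<kappa>"
  define P M where "P = q g\<^sub>m g\<^sub>p" and "M = q g\<^sub>m g\<^sub>m"
  have lin_q: "q g\<^sub>m u = cp u * P + cm u * M" if u: "u \<in> hplus A" for u
  proof -
    obtain h h' where h: "(h, h') \<in> A" and eq: "u = h + cp u *\<^sub>C g\<^sub>p + cm u *\<^sub>C g\<^sub>m"
      using von_Neumann_decomposition[OF u] by blast
    note h' = Domain_hplus[OF h] cp_Domain[OF h] cm_Domain[OF h]
    have "q g\<^sub>m h = 0"
      using q_right[of h g\<^sub>m] h' by simp
    then show ?thesis
      by (subst eq) (simp add: q_add_right q_scale_right[of g\<^sub>m g\<^sub>m] q_scale_right[of g\<^sub>p g\<^sub>m]
          hplus_add hplus_scale h' P_def M_def)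
  qed
  \<comment> \<open>\<open>t\<close> spans the domain of the adjoint of \<open>T\<close> modulo that
    of \<open>A\<close>, and \<open>e\<close> does so for the quasi-kernel.\<close>
  define t e where "t = ?k *\<^sub>C g\<^sub>p - g\<^sub>m" and "e = g\<^sub>p - g\<^sub>m"
  have t: "t \<in> hplus A" "cp t = ?k" "cm t = - 1"
    by (simp_all add: t_def coord_simps)
  have e: "e \<in> hplus A" "cp e = 1" "cm e = - 1"
    by (simp_all add: e_def coord_simps)
  have eqt: "?k * P - M = 2 * \<i>"
    using q_right[of t g\<^sub>m] lin_q[OF t(1)] by (simp add: t)
  have qq: "q e t = (?k - 1) * (2 * \<i>)" "q t e = (?k * ?k - 1) * (P - M)"
    using q_eq_gm[OF e(1) t(1)] q_eq_gm[OF t(1) e(1)] lin_q[OF t(1)] lin_q[OF e(1)] eqt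
    by (simp_all add: t e)
  \<comment> \<open>Testing the quasi-kernel relation on \<open>t\<close> produces the factor
    \<open>\<kappa> - 1\<close>, which \<open>\<kappa> < 1\<close> allows to cancel.\<close>
  have "(?k - 1) * (4 * \<i> + (?k + 1) * cnj (P - M)) = 0"
    using A_hat_relation[OF t(1)] unfolding e_def[symmetric] qq by (simp add: t algebra_simps)
  moreover have k1: "?k - 1 \<noteq> 0" "?k + 1 \<noteq> 0"
    using \<kappa> by (simp_all add: complex_eq_iff)
  ultimately have "cnj (4 * \<i> + (?k + 1) * cnj (P - M)) = 0"
    by simp
  then have eqe: "(?k + 1) * (P - M) = 4 * \<i>"
    by (simp add: algebra_simps)
  have "(?k - 1) * ((?k + 1) * P - 2 * \<i>) = (?k + 1) * (?k * P - M) - (?k + 1) * (P - M) - 2 * \<i> * (?k - 1)"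
    by (simp add: algebra_simps)
  also have "\<dots> = 0"
    unfolding eqe eqt by (simp add: algebra_simps)
  finally have P: "(?k + 1) * P = 2 * \<i>"
    using k1 by simp
  have "(?k + 1) * M = (?k + 1) * P - (?k + 1) * (P - M)"
    by (simp add: algebra_simps)
  then have M: "(?k + 1) * M = - 2 * \<i>"
    unfolding P eqe by simp
  have "P = (?k + 1) * P / (?k + 1)" "M = (?k + 1) * M / (?k + 1)"
    using k1 by simp_all
  then have "P = 2 * \<i> / (1 + \<kappa>)" "M = - 2 * \<i> / (1 + \<kappa>)"
    unfolding P M by (simp_all add: add.commute)
  then show ?thesis
    using lin_q[OF u] by (simp add: algebra_simps diff_divide_distrib)
qed

lemma q_eq:
  assumes "f \<in> hplus A" "u \<in> hplus A"
  shows "q f u = cnj (cm f + \<kappa> * cp f) * (2 * \<i> / (1 + \<kappa>)) * (cp u - cm u)"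
  using q_eq_gm[OF assms] q_gm[OF assms(2)] by (simp add: mult.assoc)

lemma K_product:
  assumes f: "f \<in> hplus A" and u: "u \<in> hplus A"
  shows "K 1 u * cnj (K 1 f) = (1 - \<kappa>) / (1 + \<kappa>) * (cp u - cm u) * cnj (cp f - cm f)"
proof -
  let ?k = "complex_of_real \<kappa>"
  have k1: "1 + ?k \<noteq> 0" "2 + ?k * 2 \<noteq> 0"
    using \<kappa> by (simp_all add: complex_eq_iff)
  have "K (K_adj K f) u = K 1 u * cnj (K 1 f)"
    using L_sys K_adj_pairing[of A K] unfolding L_system_def K_adj_def by blast
  moreover have "im_part A \<AA> f = K (K_adj K f)"
    using L_sys f unfolding L_system_def by blast
  ultimately have "K 1 u * cnj (K 1 f) = im_part A \<AA> f u"
    by simp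
  \<comment> \<open>The factor is the conjugate of \<open>1 / (2 * \<i>)\<close>, since scalars act
    conjugated on functionals.\<close>
  also have "\<dots> = \<i> / 2 * (\<AA> f u - cnj (\<AA> u f))"
    using u by (simp add: im_part_def dual_scale_def bi_adjoint_def field_simps)
  also have "cnj (\<AA> u f) = cnj (q u f) + cinner (Ast u) f"
    by (simp add: q_def cinner_commute[of "Ast u" f])
  also have "cinner (Ast u) f = cinner u (Ast f) + 2 * \<i> * (cp u * cnj (cp f) - cm u * cnj (cm f))"
    using boundary_form[OF u f] by (simp add: diff_eq_eq add.commute)
  also have "\<i> / 2 * (\<AA> f u - (cnj (q u f) + (cinner u (Ast f)
        + 2 * \<i> * (cp u * cnj (cp f) - cm u * cnj (cm f)))))
      = \<i> / 2 * (q f u - cnj (q u f)) + (cp u * cnj (cp f) - cm u * cnj (cm f))"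
    by (simp add: q_def algebra_simps)
  also have "\<dots> = (1 - ?k) / (1 + ?k) * (cp u - cm u) * cnj (cp f - cm f)"
    unfolding q_eq[OF f u] q_eq[OF u f] using k1 by (simp add: divide_simps) (simp add: algebra_simps)
  finally show ?thesis by simp
qed

text \<open>The rank-one form in \<open>K_product\<close> fixes \<open>K 1\<close> up to a phase.
  Putting \<open>f = g\<^sub>p - g\<^sub>m\<close>, where \<open>cp - cm\<close> is
  \<open>2\<close>, solves for \<open>K 1 u\<close>; \<open>\<kappa> < 1\<close> keeps the divisor
  nonzero.\<close>

lemma K_eq:
  obtains \<mu> where "\<mu> * cnj \<mu> = (1 - complex_of_real \<kappa>) / (1 + \<kappa>)" "\<mu> \<noteq> 0"
    "\<And>u. u \<in> hplus A \<Longrightarrow> K 1 u = \<mu> * (cp u - cm u)"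
proof -
  let ?m = "(1 - complex_of_real \<kappa>) / (1 + \<kappa>)"
  have m: "?m \<noteq> 0" "cnj ?m = ?m"
    using \<kappa> by (auto simp: complex_eq_iff)
  define e where "e = g\<^sub>p - g\<^sub>m"
  have e: "e \<in> hplus A" "cp e = 1" "cm e = - 1"
    by (simp_all add: e_def coord_simps)
  have Ke: "K 1 e * cnj (K 1 e) = 4 * ?m"
    using K_product[OF e(1) e(1)] by (simp add: e)
  then have Ke0: "K 1 e \<noteq> 0"
    using m by auto
  define \<mu> where "\<mu> = 2 * ?m / cnj (K 1 e)"
  have "K 1 u = \<mu> * (cp u - cm u)" if "u \<in> hplus A" for u
  proof -
    have "K 1 u * cnj (K 1 e) = 2 * ?m * (cp u - cm u)"
      using K_product[OF e(1) that] by (simp add: e mult_ac)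
    then have "K 1 u = 2 * ?m * (cp u - cm u) / cnj (K 1 e)"
      using Ke0 by (simp only: nonzero_eq_divide_eq complex_cnj_zero_iff not_False_eq_True simp_thms)
    then show ?thesis
      by (simp only: \<mu>_def times_divide_eq_left)
  qed
  moreover have "\<mu> * cnj \<mu> = 4 * ?m * ?m / (K 1 e * cnj (K 1 e))"
    unfolding \<mu>_def complex_cnj_divide complex_cnj_mult m times_divide_times_eq
    by (simp only: complex_cnj_cnj complex_cnj_numeral mult_ac) simp
  then have "\<mu> * cnj \<mu> = ?m"
    unfolding Ke using m(1) by simp
  moreover have "\<mu> \<noteq> 0"
    using m(1) Ke0 by (simp add: \<mu>_def)
  ultimately show ?thesis
    using that by blast
qed

section \<open>The transfer function\<close>

lemma not_eigenvalue:
  assumes z: "z \<in> resolvent_set T" and u: "(u, z *\<^sub>C u) \<in> T"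
  shows "u = 0"
proof -
  obtain R where R: "bounded_linear R" "\<forall>(f, f') \<in> T. R (f' - z *\<^sub>C f) = f"
    using z by (auto simp: resolvent_set_def)
  then have "R (z *\<^sub>C u - z *\<^sub>C u) = u"
    using u by blast
  then show ?thesis
    using linear_simps(3)[OF R(1)] by simp
qed

text \<open>On the deficiency space \<open>Ast u\<close> equals \<open>z *\<^sub>C u\<close>, so
  \<open>\<AA> - z\<close> acts as \<open>q\<close>. Two solutions differ by a solution of the
  homogeneous equation, an eigenvector of \<open>T\<close>, hence zero.\<close>

lemma bi_resolvent_eqI:
  assumes z: "z \<in> resolvent_set T" and u: "u \<in> deficiency_space A z"
    and eq: "\<And>v. v \<in> hplus A \<Longrightarrow> q u v = \<phi> v" and \<phi>: "\<phi> \<in> hminus A"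
  shows "bi_resolvent A \<AA> z \<phi> = u"
  unfolding bi_resolvent_def
proof (rule the_equality)
  have up: "u \<in> hplus A" "Ast u = z *\<^sub>C u"
    using u by (simp_all add: deficiency_space_iff)
  have "(\<AA> u - h_embed A (z *\<^sub>C u)) v = \<phi> v" for v
  proof (cases "v \<in> hplus A")
    case True
    then show ?thesis
      using eq[OF True] up by (simp add: q_def h_embed_def)
  next
    case False
    then show ?thesis
      using \<phi> hminus_op[OF up(1)] by (simp add: h_embed_def hminus_def)
  qed
  then show *: "u \<in> hplus A \<and> \<AA> u - h_embed A (z *\<^sub>C u) = \<phi>"
    using up by blast
  fix w assume w: "w \<in> hplus A \<and> \<AA> w - h_embed A (z *\<^sub>C w) = \<phi>"
  have "\<AA> ((w - u) + u) = \<AA> (w - u) + \<AA> u"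
    using bounded w up hplus_diff unfolding bounded_plus_minus_def by blast
  then have "\<AA> (w - u) = \<AA> w - \<AA> u"
    by simp
  also have "\<dots> = h_embed A (z *\<^sub>C w) - h_embed A (z *\<^sub>C u)"
    using w * by (metis (no_types, lifting) add_diff_cancel_left' diff_add_cancel diff_diff_eq2)
  also have "\<dots> = h_embed A (z *\<^sub>C (w - u))"
    by (auto simp: h_embed_def fun_eq_iff cinner_simps complex_vector.scale_right_diff_distrib)
  finally have "(w - u, z *\<^sub>C (w - u)) \<in> T"
    using w up hplus_diff by (simp add: T_eq main_operator_def)
  from not_eigenvalue[OF z this] show "w = u" by simp
qed

theorem transfer_function_eq:
  assumes zp: "0 < Im z" and z: "z \<in> resolvent_set T"
  defines "S \<equiv> characteristic_function A (complex_of_real \<kappa>) g\<^sub>p g\<^sub>m z"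
  shows "S \<noteq> 0" and "transfer_function A \<AA> K z = 1 / S"
proof -
  let ?k = "complex_of_real \<kappa>"
  have k1: "1 + ?k \<noteq> 0"
    using \<kappa> by (simp add: complex_eq_iff)
  define g where "g = defect 1 z"
  have g: "g \<in> deficiency_space A z" "g \<noteq> 0"
    using defect_mem[of 1 z] defect_nonzero[of 1 z] zp by (simp_all add: g_def)
  then have gp': "g \<in> hplus A" "Ast g = z *\<^sub>C g"
    by (simp_all add: deficiency_space_iff)
  define a b where "a = cp g" and "b = cm g"
  have s: "liv z = - b / a" and a0: "a \<noteq> 0"
    using livsic_eq[OF zp g] by (simp_all add: a_def b_def)
  \<comment> \<open>Otherwise \<open>g\<close> would be an eigenvector of \<open>T\<close> at the
    regular point \<open>z\<close>.\<close>
  have ba: "b + ?k * a \<noteq> 0"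
    using T_memI[OF gp'(1)] gp'(2) not_eigenvalue[OF z] g(2) by (auto simp: a_def b_def)
  have ab: "a + ?k * b \<noteq> 0"
  proof
    assume "a + ?k * b = 0"
    then have "cmod a = cmod (?k * b)"
      by (metis add_eq_0_iff norm_minus_cancel)
    also have "\<dots> \<le> 1 * cmod b"
      using \<kappa> unfolding norm_mult by (intro mult_right_mono) auto
    finally show False
      using deficiency_coord_less[OF g zp] by (simp add: a_def b_def)
  qed
  have "liv z - ?k = - ((b + ?k * a) / a)" "cnj ?k * liv z - 1 = - ((a + ?k * b) / a)"
    using a0 by (simp_all add: s field_simps)
  then have S: "S = (b + ?k * a) / (a + ?k * b)"
    using a0 unfolding S_def characteristic_function_def by (simp only: minus_divide_divide) simp
  then show "S \<noteq> 0"
    using ba ab by simp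
  obtain \<mu> where \<mu>: "\<mu> * cnj \<mu> = (1 - ?k) / (1 + \<kappa>)" "\<mu> \<noteq> 0"
    and K1: "\<And>u. u \<in> hplus A \<Longrightarrow> K 1 u = \<mu> * (cp u - cm u)"
    using K_eq by blast
  \<comment> \<open>Solves \<open>cnj (cm u + \<kappa> * cp u) * (2 * \<i> / (1 + \<kappa>)) =
    \<mu>\<close> for \<open>u = t *\<^sub>C g\<close>, so that \<open>q u\<close> agrees with
    \<open>K 1\<close>.\<close>
  define t where "t = cnj \<mu> * (1 + ?k) * \<i> / 2 / (b + ?k * a)"
  define u where "u = t *\<^sub>C g"
  have u: "u \<in> deficiency_space A z"
    by (simp add: u_def deficiency_space_iff coord_simps gp' Ast_scale scaleC_scaleC mult.commute)
  then have up: "u \<in> hplus A" by (simp add: deficiency_space_iff)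
  have "cm u + ?k * cp u = t * (b + ?k * a)"
    by (simp add: u_def coord_simps gp' a_def b_def algebra_simps)
  also have "\<dots> = cnj \<mu> * (1 + ?k) * \<i> / 2"
    by (rule nonzero_eq_divide_eq[THEN iffD1, OF ba t_def])
  finally have cu: "cm u + ?k * cp u = cnj \<mu> * (1 + ?k) * \<i> / 2" .
  have "q u v = K 1 v" if v: "v \<in> hplus A" for v
    unfolding q_eq[OF up v] cu K1[OF v] using k1 by (simp add: divide_simps) (simp add: algebra_simps)
  moreover have "K 1 \<in> hminus A"
    using L_sys unfolding L_system_def bounded_C_minus_def by blast
  ultimately have "bi_resolvent A \<AA> z (K 1) = u"
    by (intro bi_resolvent_eqI[OF z u])
  then have "transfer_function A \<AA> K z = 1 - 2 * \<i> * (\<mu> * (t * (a - b)))"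
    using K1[OF up] by (simp add: transfer_function_def K_adj_def u_def coord_simps gp' a_def b_def
        right_diff_distrib)
  \<comment> \<open>The undetermined phase of \<open>\<mu>\<close> drops out: only
    \<open>\<mu> * cnj \<mu>\<close> enters.\<close>
  also have "\<dots> = 1 + (\<mu> * cnj \<mu>) * (1 + ?k) * (a - b) / (b + ?k * a)"
  proof -
    have "2 * \<i> * (\<mu> * (cnj \<mu> * (1 + ?k) * \<i> / 2 / d * (a - b)))
        = - ((\<mu> * cnj \<mu>) * (1 + ?k) * (a - b) / d)" for d
      by (cases "d = 0") (simp_all add: field_simps)
    then show ?thesis
      unfolding t_def by (simp only: diff_minus_eq_add)
  qed
  also have "\<dots> = 1 / S"
    unfolding \<mu>(1) S using k1 ba ab by (simp add: divide_simps) (simp add: algebra_simps)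
  finally show "transfer_function A \<AA> K z = 1 / S" .
qed

end

theorem theorem7:
  fixes A T A_hat :: "('a::chilbert_space \<times> 'a) set"
    and \<AA> :: "'a \<Rightarrow> 'a \<Rightarrow> complex"
    and K :: "complex \<Rightarrow> 'a \<Rightarrow> complex"
    and \<kappa> :: real
    and g\<^sub>p g\<^sub>m :: 'a
  assumes "linear_operator A" and "closed A" and "densely_defined A"
    and "symmetric_operator A" and "deficiency_indices_1_1 A"
    and "L_system A \<AA> K"
    and "T = main_operator A \<AA>"
    and "A_hat = quasi_kernel A (re_part A \<AA>)"
    and "0 \<le> \<kappa>" and "\<kappa> < 1"
    and "hypothesis_H A T A_hat (complex_of_real \<kappa>) g\<^sub>p g\<^sub>m"
  shows "(\<forall>z \<in> upper_half_plane \<inter> resolvent_set T.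
            characteristic_function A (complex_of_real \<kappa>) g\<^sub>p g\<^sub>m z \<noteq> 0
            \<and> transfer_function A \<AA> K z
                = 1 / characteristic_function A (complex_of_real \<kappa>) g\<^sub>p g\<^sub>m z)
       \<and> (\<exists>S \<in> L_kappa_class (complex_of_real \<kappa>).
            \<forall>z \<in> upper_half_plane \<inter> resolvent_set T. 1 / transfer_function A \<AA> K z = S z)"
proof -
  interpret L_system_H A g\<^sub>p g\<^sub>m T A_hat \<AA> K \<kappa>
    by unfold_locales (use assms in \<open>simp_all add: hypothesis_H_def\<close>)
  \<comment> \<open>The characteristic function itself is the member of the class that agrees with
    the reciprocal of the transfer function at regular points.\<close>
  have "characteristic_function A (complex_of_real \<kappa>) g\<^sub>p g\<^sub>m \<in> L_kappa_class (complex_of_real \<kappa>)"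
    unfolding L_kappa_class_def characteristic_function_def using livsic_in_L_class by blast
  then show ?thesis
    using transfer_function_eq by (intro conjI ballI bexI) auto
qed

end
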